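(* Let $\delta=0.525$. For every real $\alpha$ with $0<\alpha<1$, as $n\to\infty$, \[ f_{\lfloor n^\alpha\rfloor}(n)=\frac{1}{2\lfloor n^\alpha\rfloor}n^{2}+ \begin{cases} O(n^{2-\frac{3}{2}\alpha}) & \text{if } 0<\alpha\leq\frac{1-\delta}{2-\delta},\\ O(n^{2-\alpha-\frac{1}{2}(1-\delta)(1-\alpha)}) & \text{if } \frac{1-\delta}{2-\delta}<\alpha<1. \end{cases} \]
   Context: Let $k$ be a positive integer and $A$ a finite set (alphabet). A sequence $x_1,\ldots,x_m$ of elements of $A$ is a $k$-radius sequence over $A$ if for every $a,b\in A$ there are indices $i,j\in\{1,\ldots,m\}$ with $x_i=a$, $x_j=b$ and $|i-j|\leq k$. $f_k(n)$ denotes the length of a shortest $k$-radius sequence over an $n$-element alphabet. *)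

theory Defs
  imports Complex_Main "HOL-Library.Landau_Symbols"
begin

definition radius_sequence :: "nat \<Rightarrow> 'a set \<Rightarrow> 'a list \<Rightarrow> bool" where
  "radius_sequence k A xs \<longleftrightarrow>
     set xs \<subseteq> A \<and>
     (\<forall>a\<in>A. \<forall>b\<in>A. \<exists>i<length xs. \<exists>j<length xs.
        xs ! i = a \<and> xs ! j = b \<and> \<bar>int i - int j\<bar> \<le> int k)"

text \<open>The choice of the \<open>n\<close>-element alphabet \<open>{..<n}\<close> is immaterial, see
  \<open>min_radius_length_eq\<close>; the minimum is attained for \<open>k > 0\<close>, see
  \<open>min_radius_length_attained\<close>.\<close>

definition min_radius_length :: "nat \<Rightarrow> nat \<Rightarrow> nat" where
  "min_radius_length k n =
     (LEAST m. \<exists>xs. radius_sequence k {..<n} xs \<and> length xs = m)"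

lemma radius_sequence_map:
  assumes "radius_sequence k A xs" and "g ` A = B"
  shows "radius_sequence k B (map g xs)"
  unfolding radius_sequence_def
proof (intro conjI ballI)
  show "set (map g xs) \<subseteq> B"
    using assms by (auto simp: radius_sequence_def)
next
  fix a b assume "a \<in> B" "b \<in> B"
  then obtain a' b' where ab: "a' \<in> A" "b' \<in> A" "a = g a'" "b = g b'"
    using assms(2) by blast
  then obtain i j where "i < length xs" "j < length xs" "xs ! i = a'" "xs ! j = b'"
    "\<bar>int i - int j\<bar> \<le> int k"
    using assms(1) unfolding radius_sequence_def by blast
  then show "\<exists>i<length (map g xs). \<exists>j<length (map g xs).
      map g xs ! i = a \<and> map g xs ! j = b \<and> \<bar>int i - int j\<bar> \<le> int k"
    using ab by (intro exI[of _ i] exI[of _ j] conjI) auto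
qed

lemma min_radius_length_eq:
  assumes "finite A" and "card A = n"
  shows "min_radius_length k n =
    (LEAST m. \<exists>xs. radius_sequence k A xs \<and> length xs = m)"
proof -
  obtain h where h: "bij_betw h {..<n} A"
    using assms ex_bij_betw_nat_finite[of A] by (auto simp: atLeast0LessThan)
  have 1: "h ` {..<n} = A" and 2: "inv_into {..<n} h ` A = {..<n}"
    using h bij_betw_inv_into[OF h] by (auto simp: bij_betw_def)
  have "(\<exists>xs. radius_sequence k {..<n} xs \<and> length xs = m) \<longleftrightarrow>
        (\<exists>xs. radius_sequence k A xs \<and> length xs = m)" for m
    using radius_sequence_map[OF _ 1] radius_sequence_map[OF _ 2] by (metis length_map)
  then show ?thesis
    unfolding min_radius_length_def by simp
qed

lemma radius_sequence_exists:
  fixes n :: nat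
  assumes "k > 0"
  shows "\<exists>xs. radius_sequence k {..<n} xs"
proof -
  define ps where "ps = List.product [0..<n] [0..<n]"
  define xs where "xs = concat (map (\<lambda>(a, b). [a, b]) ps)"
  have "\<exists>i<length xs. \<exists>j<length xs.
      xs ! i = a \<and> xs ! j = b \<and> \<bar>int i - int j\<bar> \<le> int k" if "a < n" "b < n" for a b
  proof -
    have "(a, b) \<in> set ps"
      using that by (auto simp: ps_def)
    then obtain us vs where "ps = us @ (a, b) # vs"
      by (meson split_list)
    then obtain us' vs' where xs: "xs = us' @ [a, b] @ vs'"
      by (auto simp: xs_def)
    show ?thesis
      using assms
      by (intro exI[of _ "length us'"] exI[of _ "Suc (length us')"] conjI)
         (auto simp: xs nth_append)
  qed
  moreover have "set xs \<subseteq> {..<n}"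
    by (auto simp: xs_def ps_def)
  ultimately have "radius_sequence k {..<n} xs"
    by (auto simp: radius_sequence_def)
  then show ?thesis ..
qed

lemma min_radius_length_attained:
  assumes "k > 0"
  shows "\<exists>xs. radius_sequence k {..<n} xs \<and> length xs = min_radius_length k n"
  unfolding min_radius_length_def
  by (rule LeastI_ex) (use radius_sequence_exists[OF assms] in blast)

end

theory Submission
  imports
    Defs
    "HOL-Analysis.Analysis"
    "HOL-Computational_Algebra.Squarefree"
    "HOL-Number_Theory.Totient"
    "HOL-Real_Asymp.Real_Asymp"
begin

text \<open>
  The lower bound \<open>n (n - 1) \<le> 2 k f\<^sub>k(n)\<close> counts pairs of positions at distance at most \<open>k\<close>.

  For the upper bound let \<open>s = 2 r + 1\<close>, let \<open>N\<close> be coprime to \<open>1, \<dots>, 2 r\<close>, and arrange the letters in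
  blocks of size \<open>b \<approx> k / r\<close>, one for each point \<open>(x, i)\<close> of the grid \<open>\<int>/N \<times> {0, \<dots>, s - 1}\<close>. For each slope
  \<open>a\<close> list the lines \<open>i \<mapsto> (a i + j, i)\<close> for \<open>j = 0, \<dots>, N\<close> one after the other. Points in
  different columns \<open>i < i'\<close> meet within distance \<open>r\<close>: on one line if \<open>i' - i \<le> r\<close>, and on two
  consecutive lines otherwise, since the relevant slope solves a linear congruence with the unit \<open>i' - i\<close>.
  This is optimal up to a factor \<open>1 + O(1 / r + r / k)\<close>, and pairs in the same column are rare
  enough to be treated crudely.

  It remains to find \<open>N\<close> near \<open>X \<approx> n / (2 k)\<close>. Primes in short intervals are not needed: all that matters
  is that \<open>N\<close> lies in \<open>[X, X + X\<^sup>0\<^sup>.\<^sup>7\<^sup>6\<^sup>2\<^sup>5]\<close> and has no prime factor up to \<open>X\<^sup>0\<^sup>.\<^sup>2\<^sup>3\<^sup>7\<^sup>5\<close>. Because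
  \<open>0.2375 < 1/4\<close>, this follows from Selberg's sieve weights \<open>\<lambda>(n)\<^sup>2\<close>: under them an integer of the
  interval has on average less than one prime factor up to \<open>X\<^sup>0\<^sup>.\<^sup>2\<^sup>3\<^sup>7\<^sup>5\<close>.
\<close>

section \<open>Sums over squarefree numbers and primes\<close>

(* This is 1 / phi(l) when l is squarefree. *)
definition inv_phi :: "nat \<Rightarrow> real" where
  "inv_phi l = (\<Prod>p\<in>prime_factors l. 1 / (real p - 1))"

lemma has_sum_geometric_prime:
  fixes p :: nat
  assumes "p > 1"
  shows "((\<lambda>j::nat. 1 / real p ^ Suc j) has_sum (1 / (real p - 1))) UNIV"
proof -
  have "(\<lambda>j::nat. (1 / real p) * (1 / real p) ^ j) sums ((1 / real p) * (1 / (1 - 1 / real p)))"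
    using assms by (intro sums_mult geometric_sums) auto
  also have "(1 / real p) * (1 / (1 - 1 / real p)) = 1 / (real p - 1)"
    using assms by (simp add: field_simps)
  finally have "(\<lambda>j::nat. 1 / real p ^ Suc j) sums (1 / (real p - 1))"
    by (simp add: power_divide)
  then show ?thesis
    by (intro norm_summable_imp_has_sum) (auto simp: sums_iff)
qed

text \<open>The multiplicity of \<open>p\<close> recovers \<open>j\<close>, and cancellation then
  recovers \<open>m\<close>. The exponent is \<open>Suc j\<close> because \<open>p\<close> has to
  occur at least once.\<close>

lemma bij_betw_prime_power_mult:
  fixes p :: nat
  assumes p: "prime p" "p \<notin> P"
  shows "bij_betw (\<lambda>(j, m). p ^ Suc j * m) (UNIV \<times> {m. m > 0 \<and> prime_factors m = P})
           {m. m > 0 \<and> prime_factors m = insert p P}"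
proof (rule bij_betw_imageI)
  show "inj_on (\<lambda>(j, m). p ^ Suc j * m) (UNIV \<times> {m. m > 0 \<and> prime_factors m = P})"
  proof (rule inj_onI, clarify)
    fix j m j' m'
    assume m: "m > 0" "P = prime_factors m" and m': "m' > 0" "prime_factors m' = prime_factors m"
      and eq: "p ^ Suc j * m = p ^ Suc j' * m'"
    have nd: "\<not> p dvd m" "\<not> p dvd m'"
      using m m' p by (auto simp: prime_factors_dvd)
    have "multiplicity p (p ^ Suc j * m) = Suc j" "multiplicity p (p ^ Suc j' * m') = Suc j'"
      using nd p m m' by (auto simp: prime_elem_multiplicity_mult_distrib not_dvd_imp_multiplicity_0
          multiplicity_same_power simp del: power_Suc)
    with eq have "j = j'" by (simp del: power_Suc)
    moreover from this have "m = m'" using eq p by (simp del: power_Suc)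
    ultimately show "j = j' \<and> m = m'" by simp
  qed
  show "(\<lambda>(j, m). p ^ Suc j * m) ` (UNIV \<times> {m. m > 0 \<and> prime_factors m = P}) =
      {m. m > 0 \<and> prime_factors m = insert p P}"
  proof (intro equalityI subsetI)
    fix x assume "x \<in> (\<lambda>(j, m). p ^ Suc j * m) ` (UNIV \<times> {m. m > 0 \<and> prime_factors m = P})"
    then obtain j m where x: "x = p ^ Suc j * m" "m > 0" "prime_factors m = P" by auto
    then have "prime_factors x = insert p P"
      using p by (auto simp: prime_factors_product prime_factorization_prime_power prime_factors_power simp del: power_Suc)
    then show "x \<in> {m. m > 0 \<and> prime_factors m = insert p P}" using x p by (auto simp: prime_gt_0_nat)
  next
    fix x assume "x \<in> {m. m > 0 \<and> prime_factors m = insert p P}"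
    then have x: "x > 0" "prime_factors x = insert p P" by auto
    then have pd: "p dvd x" by (auto simp: prime_factors_dvd)
    have mult: "multiplicity p x > 0" using pd x p by (simp add: prime_multiplicity_gt_zero_iff)
    then obtain j where j: "multiplicity p x = Suc j" using gr0_conv_Suc by blast
    have "\<not> is_unit p" using p by auto
    then obtain m where m: "x = p ^ Suc j * m" "\<not> p dvd m"
      using multiplicity_decompose'[of x p] x(1) unfolding j by (metis less_numeral_extra(3))
    have m0: "m > 0" using m(1) x(1) by (auto intro: Nat.gr0I)
    have "prime_factors x = insert p (prime_factors m)"
      using p m0 unfolding m(1)
      by (auto simp: prime_factors_product prime_factorization_prime_power prime_factors_power simp del: power_Suc)
    moreover have "p \<notin> prime_factors m" using m(2) by auto
    ultimately have "prime_factors m = P" using x p by auto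
    then show "x \<in> (\<lambda>(j, m). p ^ Suc j * m) ` (UNIV \<times> {m. m > 0 \<and> prime_factors m = P})"
      using m(1) m0 by (intro image_eqI[of _ _ "(j, m)"]) auto
  qed
qed

text \<open>Euler product over \<open>P\<close>, one prime at a time: the exponent of each prime
  runs over all positive integers, which gives a geometric series with sum
  \<open>1 / (p - 1)\<close>. This links \<open>inv_phi\<close> to harmonic sums.\<close>

lemma has_sum_fixed_prime_factors:
  assumes "finite P" "\<And>p. p \<in> P \<Longrightarrow> prime (p::nat)"
  shows "((\<lambda>m. 1 / real m) has_sum (\<Prod>p\<in>P. 1 / (real p - 1))) {m. m > 0 \<and> prime_factors m = P}"
  using assms
proof (induction P rule: finite_induct)
  case empty
  have "{m::nat. m > 0 \<and> prime_factors m = {}} = {1}"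
    by (auto simp: prime_factorization_empty_iff set_mset_eq_empty_iff)
  then show ?case using has_sum_finite[of "{1::nat}" "\<lambda>m. 1 / real m"] by simp
next
  case (insert p P)
  let ?M = "{m. m > 0 \<and> prime_factors m = P}"
  have p: "prime p" "p > 1" using insert prime_gt_1_nat by auto
  have 1: "((\<lambda>m. 1 / real m) has_sum (\<Prod>p\<in>P. 1 / (real p - 1))) ?M"
    using insert by auto
  have 2: "((\<lambda>j::nat. 1 / real p ^ Suc j) has_sum (1 / (real p - 1))) UNIV"
    using p by (intro has_sum_geometric_prime)
  have 3: "((\<lambda>y. case (j, y) of (j, m) \<Rightarrow> 1 / real p ^ Suc j * (1 / real m)) has_sum
      1 / real p ^ Suc j * (\<Prod>p\<in>P. 1 / (real p - 1))) ?M" for j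
    using has_sum_cmult_right[OF 1, of "1 / real p ^ Suc j"] by simp
  have 4: "((\<lambda>j. 1 / real p ^ Suc j * (\<Prod>p\<in>P. 1 / (real p - 1))) has_sum
      1 / (real p - 1) * (\<Prod>p\<in>P. 1 / (real p - 1))) UNIV"
    by (intro has_sum_cmult_left 2)
  have "((\<lambda>(j, m). 1 / real p ^ Suc j * (1 / real m)) has_sum
      (1 / (real p - 1)) * (\<Prod>p\<in>P. 1 / (real p - 1))) (UNIV \<times> ?M)"
    by (rule has_sum_SigmaI[OF 3 4], rule summable_on_SigmaI[OF 3 has_sum_imp_summable[OF 4]]) auto
  then have "((\<lambda>jm. 1 / real ((\<lambda>(j, m). p ^ Suc j * m) jm)) has_sum
      (1 / (real p - 1)) * (\<Prod>p\<in>P. 1 / (real p - 1))) (UNIV \<times> ?M)"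
    by (simp add: case_prod_unfold)
  then have "((\<lambda>m. 1 / real m) has_sum
      (1 / (real p - 1)) * (\<Prod>p\<in>P. 1 / (real p - 1))) {m. m > 0 \<and> prime_factors m = insert p P}"
    using has_sum_reindex_bij_betw[OF bij_betw_prime_power_mult[OF p(1) insert(2)], where f="\<lambda>m. 1 / real m"]
    by simp
  then show ?case using insert by simp
qed

section \<open>The sum of 1 / phi over squarefree numbers compared with the harmonic sum\<close>

definition sqfree_upto :: "nat \<Rightarrow> nat set" where
  "sqfree_upto N = {l. 0 < l \<and> l \<le> N \<and> squarefree l}"

definition inv_phi_sum :: "nat \<Rightarrow> real" where
  "inv_phi_sum N = (\<Sum>l\<in>sqfree_upto N. inv_phi l)"

lemma finite_sqfree_upto [simp, intro]: "finite (sqfree_upto N)"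
  by (rule finite_subset[of _ "{..N}"]) (auto simp: sqfree_upto_def)

lemma inv_phi_nonneg: "inv_phi l \<ge> 0"
  unfolding inv_phi_def by (intro prod_nonneg) (auto dest!: in_prime_factors_imp_prime prime_gt_1_nat)

lemma prod_prime_factors_squarefree:
  assumes "squarefree (l::nat)" "l > 0"
  shows "\<Prod>(prime_factors l) = l"
proof -
  have "l = (\<Prod>p\<in>prime_factors l. p ^ multiplicity p l)"
    using assms by (simp add: prime_factorization_nat)
  also have "\<dots> = \<Prod>(prime_factors l)"
    using assms squarefree_factorial_semiring'[of l]
    by (intro prod.cong) (auto simp: )
  finally show ?thesis by simp
qed

lemma prime_factors_prod_primes:
  assumes "finite P" "\<And>p. p \<in> P \<Longrightarrow> prime (p::nat)"
  shows "prime_factors (\<Prod>P) = P"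
  using assms
  by (subst prime_factors_prod) (auto simp: prime_factorization_prime dest: not_prime_0[THEN notE])

lemma squarefree_prod_primes:
  assumes "finite P" "\<And>p. p \<in> P \<Longrightarrow> prime (p::nat)"
  shows "squarefree (\<Prod>P)"
  using assms by (intro squarefree_prod_coprime) (auto simp: primes_coprime squarefree_prime)

lemma prod_prime_factors_dvd:
  assumes "n > 0"
  shows "\<Prod>(prime_factors n) dvd (n::nat)"
proof -
  have "\<Prod>(prime_factors n) dvd (\<Prod>p\<in>prime_factors n. p ^ multiplicity p n)"
    by (intro prod_dvd_prod dvd_power) (auto simp: prime_factors_multiplicity)
  also have "\<dots> = n"
    using assms prime_factorization_nat[of n] by simp
  finally show ?thesis .
qed

lemma rad_in_sqfree_upto:
  assumes "m > 0" "m \<le> N"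
  shows "\<Prod>(prime_factors m) \<in> sqfree_upto N"
proof -
  have "\<Prod>(prime_factors m) dvd m" using assms prod_prime_factors_dvd by blast
  then have "\<Prod>(prime_factors m) \<le> m" "\<Prod>(prime_factors m) > 0"
    using assms by (auto intro: dvd_imp_le Nat.gr0I)
  moreover have "squarefree (\<Prod>(prime_factors m))"
    by (intro squarefree_prod_primes) auto
  ultimately show ?thesis using assms by (auto simp: sqfree_upto_def)
qed

lemma inv_phi_has_sum: "((\<lambda>m. 1 / real m) has_sum inv_phi l) {m. m > 0 \<and> prime_factors m = prime_factors l}"
  unfolding inv_phi_def by (rule has_sum_fixed_prime_factors) auto

text \<open>Group the \<open>m \<le> N\<close> by their radical \<open>l\<close>, which is
  squarefree and at most \<open>N\<close>. Each group is part of the full series over the integers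
  with the prime factors of \<open>l\<close>, whose sum is \<open>inv_phi l\<close>.\<close>

lemma harm_le_inv_phi_sum: "harm N \<le> inv_phi_sum N"
proof -
  let ?S = "\<lambda>l. {m \<in> {1..N}. \<Prod>(prime_factors m) = l}"
  have "harm N = (\<Sum>m\<in>{1..N}. 1 / real m)"
    by (simp add: harm_def inverse_eq_divide)
  also have "\<dots> = (\<Sum>l\<in>sqfree_upto N. \<Sum>m\<in>?S l. 1 / real m)"
    by (rule sum.group[symmetric]) (auto intro: rad_in_sqfree_upto)
  also have "\<dots> \<le> (\<Sum>l\<in>sqfree_upto N. inv_phi l)"
  proof (rule sum_mono)
    fix l assume "l \<in> sqfree_upto N"
    have "prime_factors m = prime_factors l" if "m \<in> ?S l" for m
      using that prime_factors_prod_primes[of "prime_factors m"] by auto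
    then have sub: "?S l \<subseteq> {m. m > 0 \<and> prime_factors m = prime_factors l}" by auto
    have "(\<Sum>m\<in>?S l. 1 / real m) \<le> infsum (\<lambda>m. 1 / real m) {m. m > 0 \<and> prime_factors m = prime_factors l}"
      using has_sum_imp_summable[OF inv_phi_has_sum] sub by (intro finite_sum_le_infsum) auto
    then show "(\<Sum>m\<in>?S l. 1 / real m) \<le> inv_phi l"
      using infsumI[OF inv_phi_has_sum[of l]] by simp
  qed
  finally show ?thesis by (simp add: inv_phi_sum_def)
qed

text \<open>The window is the interval from \<open>N div a ^ 2\<close> (exclusive) to
  \<open>N\<close>, so its sum is a difference of harmonic numbers. As \<open>harm n - ln n\<close>
  decreases, this is at most the logarithm of the ratio of the ends, about \<open>2 * ln a\<close>;
  the summand 1 pays for rounding and for the case \<open>N div a ^ 2 = 0\<close>.\<close>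

lemma sum_inverse_window_le:
  fixes a N :: nat
  assumes "a > 0"
  shows "(\<Sum>b | b \<le> N \<and> N < a ^ 2 * b. 1 / real b) \<le> 1 + 2 * ln (real a)"
proof (cases "N = 0")
  case True
  then have "{b. b \<le> N \<and> N < a ^ 2 * b} = {}" by auto
  then show ?thesis using assms by (simp only:) simp
next
  case False
  define q where "q = N div a ^ 2"
  have a2: "a ^ 2 > 0" using assms by simp
  have q: "q \<le> N" by (simp add: q_def)
  have eq: "{b. b \<le> N \<and> N < a ^ 2 * b} = {q<..N}"
    using a2 by (auto simp: q_def div_less_iff_less_mult mult.commute)
  have "{1..N} = {1..q} \<union> {q<..N}" using q by auto
  then have "(\<Sum>b\<in>{1..N}. 1 / real b) = (\<Sum>b\<in>{1..q}. 1 / real b) + (\<Sum>b\<in>{q<..N}. 1 / real b)"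
    by (simp only: sum.union_disjoint[of "{1..q}" "{q<..N}" "\<lambda>b. 1 / real b"] finite_atLeastAtMost
        finite_greaterThanAtMost ivl_disj_int)
  then have sum: "(\<Sum>b\<in>{q<..N}. 1 / real b) = harm N - harm q"
    by (simp add: harm_def inverse_eq_divide)
  have lt: "N < a ^ 2 * (q + 1)"
    using a2 unfolding q_def by (metis Suc_eq_plus1 dividend_less_times_div mult_Suc_right add.commute)
  have "harm N - harm q \<le> 1 + 2 * ln (real a)"
  proof (cases "q = 0")
    case True
    have "harm N - ln (real N) \<le> harm 1 - ln (real 1)"
      using False by (intro euler_mascheroni_sequence_decreasing) auto
    moreover have "real N \<le> real (a ^ 2)"
      using lt True by (intro of_nat_mono) simp
    then have "ln (real N) \<le> ln (real a ^ 2)"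
      using False by (subst ln_le_cancel_iff) (use assms in auto)
    ultimately show ?thesis using True assms by (simp add: harm_def ln_realpow)
  next
    case q0: False
    have "harm N - ln (real N) \<le> harm q - ln (real q)"
      using q0 q by (intro euler_mascheroni_sequence_decreasing) auto
    moreover have "real N \<le> 2 * real a ^ 2 * real q"
    proof -
      have "N \<le> a ^ 2 * (q + 1)" using lt by simp
      also have "\<dots> \<le> a ^ 2 * (2 * q)" using q0 by (intro mult_left_mono) auto
      finally have "real N \<le> real (a ^ 2 * (2 * q))" by (rule of_nat_mono)
      then show ?thesis by (simp add: mult_ac)
    qed
    then have "ln (real N) \<le> ln (2 * real a ^ 2 * real q)"
      using False assms q0 by simp
    then have "ln (real N) \<le> ln 2 + 2 * ln (real a) + ln (real q)"
      using assms q0 by (simp add: ln_mult ln_realpow)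
    moreover have "ln 2 \<le> (1::real)" using ln_le_minus_one[of "2::real"] by simp
    ultimately show ?thesis by linarith
  qed
  then show ?thesis unfolding eq sum .
qed

lemma summable_ln_over_square: "summable (\<lambda>a::nat. (1 + 2 * ln (real a)) / real a ^ 2)"
proof (rule summable_comparison_test')
  show "summable (\<lambda>a::nat. 5 * real a powr (-3/2))"
    by (intro summable_mult) (simp add: summable_real_powr_iff)
  fix a :: nat assume a: "a \<ge> 1"
  have "ln (sqrt (real a)) \<le> sqrt (real a)"
    using ln_less_self[of "sqrt (real a)"] a by (auto simp: less_imp_le Suc_le_eq)
  then have "ln (real a) \<le> 2 * sqrt (real a)" using a by (simp add: ln_sqrt)
  moreover have "1 \<le> sqrt (real a)" "ln (real a) \<ge> 0" using a by auto
  ultimately have "\<bar>1 + 2 * ln (real a)\<bar> \<le> 5 * sqrt (real a)" by linarith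
  then have "norm ((1 + 2 * ln (real a)) / real a ^ 2) \<le> 5 * sqrt (real a) / real a ^ 2"
    by (simp add: divide_right_mono)
  moreover have "sqrt (real a) / real a ^ 2 = real a powr (-3/2)"
    using a by (simp add: powr_half_sqrt[symmetric] powr_numeral[symmetric] powr_diff[symmetric] del: powr_numeral)
  ultimately show "norm ((1 + 2 * ln (real a)) / real a ^ 2) \<le> 5 * real a powr (-3/2)"
    by (metis times_divide_eq_right)
qed

(* Only the integers m = a^2 b > N with radical at most N contribute beyond harm N; the squarefree part b
   divides the radical, so it lies in the window (N / a^2, N]. *)
lemma inv_phi_sum_le: "\<exists>C\<ge>0. \<forall>N. inv_phi_sum N \<le> harm N + C"
proof -
  define C where "C = (\<Sum>a::nat. (1 + 2 * ln (real a)) / real a ^ 2)"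
  have nn: "0 \<le> (1 + 2 * ln (real a)) / real a ^ 2" for a :: nat
    by (cases "a = 0") auto
  have "inv_phi_sum N \<le> harm N + C" for N
  proof (rule has_sum_le_finite_sums)
    let ?B = "\<lambda>l. {m::nat. m > 0 \<and> prime_factors m = prime_factors l}"
    let ?M = "\<Union>l\<in>sqfree_upto N. ?B l"
    show "((\<lambda>m. 1 / real m) has_sum inv_phi_sum N) ?M"
      unfolding inv_phi_sum_def
    proof (rule sum_has_sum)
      fix l l' assume "l \<in> sqfree_upto N" "l' \<in> sqfree_upto N" "l \<noteq> l'"
      then have "prime_factors l \<noteq> prime_factors l'"
        using prod_prime_factors_squarefree by (auto simp: sqfree_upto_def) metis
      then show "?B l \<inter> ?B l' = {}" by auto
    qed (auto intro: inv_phi_has_sum)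
    fix F assume F: "finite F" "F \<subseteq> ?M"
    let ?g = "\<lambda>m::nat. (square_part m, squarefree_part m)"
    \<comment> \<open>By \<open>has_sum_le_finite_sums\<close> only finite partial sums matter.
      Members up to \<open>N\<close> contribute at most \<open>harm N\<close>; \<open>F2\<close>
      collects the others, whose contribution has to stay below a constant.\<close>
    define F2 where "F2 = F - {1..N}"
    have "(\<Sum>m\<in>F. 1 / real m) = (\<Sum>m\<in>F \<inter> {1..N}. 1 / real m) + (\<Sum>m\<in>F2. 1 / real m)"
      unfolding F2_def using F by (intro sum.Int_Diff)
    also have "(\<Sum>m\<in>F \<inter> {1..N}. 1 / real m) \<le> (\<Sum>m\<in>{1..N}. 1 / real m)"
      by (intro sum_mono2) auto
    also have "(\<Sum>m\<in>{1..N}. 1 / real m) = harm N"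
      by (simp add: harm_def inverse_eq_divide)
    also have "(\<Sum>m\<in>F2. 1 / real m) \<le> C"
    proof -
      define K where "K = Max (insert 0 F)"
      have F2: "square_part m \<in> {1..K} \<and> squarefree_part m \<le> N \<and> N < square_part m ^ 2 * squarefree_part m"
        if m: "m \<in> F2" for m
      proof -
        from m F obtain l where l: "l \<in> sqfree_upto N" "m > 0" "prime_factors m = prime_factors l" "m > N"
          by (auto simp: F2_def)
        have sq: "square_part m > 0" using l by (auto intro: Nat.gr0I)
        have "square_part m \<le> square_part m ^ 2" using sq by (simp add: power2_eq_square)
        also have "\<dots> \<le> m" using l by (intro dvd_imp_le) auto
        also have "m \<le> K" using m F by (auto simp: K_def F2_def)
        finally have 1: "square_part m \<in> {1..K}" using sq by auto
        have dm: "squarefree_part m dvd m" using squarefree_decompose[of m] by (metis dvd_triv_left)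
        have b0: "squarefree_part m > 0" by (auto intro: Nat.gr0I)
        have "squarefree_part m = \<Prod>(prime_factors (squarefree_part m))"
          using b0 by (simp add: prod_prime_factors_squarefree)
        also have "\<dots> dvd \<Prod>(prime_factors m)"
          using dm l by (intro prod_dvd_prod_subset dvd_prime_factors) auto
        also have "\<Prod>(prime_factors m) = l"
          using l prod_prime_factors_squarefree by (auto simp: sqfree_upto_def)
        finally have "squarefree_part m \<le> l" using l by (auto simp: sqfree_upto_def intro: dvd_imp_le)
        then have 2: "squarefree_part m \<le> N" using l by (auto simp: sqfree_upto_def)
        have "m = square_part m ^ 2 * squarefree_part m"
          using squarefree_decompose[of m] by (simp add: mult.commute)
        with l have "N < square_part m ^ 2 * squarefree_part m" by linarith
        with 1 2 show ?thesis by blast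
      qed
      \<comment> \<open>Since \<open>m\<close> is determined by its square part and its squarefree
        part, the sum may be enlarged to all pairs \<open>(a, b)\<close> with \<open>b\<close> in
        the window of \<open>a\<close>.\<close>
      have inj: "inj_on ?g F2"
        by (intro inj_onI) (metis prod.inject squarefree_decompose)
      have "(\<Sum>m\<in>F2. 1 / real m) = (\<Sum>m\<in>F2. case ?g m of (a, b) \<Rightarrow> 1 / (real a ^ 2 * real b))"
      proof (rule sum.cong)
        fix m
        have "real m = real (square_part m) ^ 2 * real (squarefree_part m)"
          by (subst squarefree_decompose) simp
        then show "1 / real m = (case ?g m of (a, b) \<Rightarrow> 1 / (real a ^ 2 * real b))" by simp
      qed simp
      also have "\<dots> = (\<Sum>(a, b)\<in>?g ` F2. 1 / (real a ^ 2 * real b))"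
        by (subst sum.reindex[OF inj]) (simp add: o_def)
      also have "\<dots> \<le> (\<Sum>(a, b)\<in>Sigma {1..K} (\<lambda>a. {b. b \<le> N \<and> N < a ^ 2 * b}). 1 / (real a ^ 2 * real b))"
        using F2 by (intro sum_mono2) auto
      also have "\<dots> = (\<Sum>a\<in>{1..K}. \<Sum>b | b \<le> N \<and> N < a ^ 2 * b. 1 / (real a ^ 2 * real b))"
        by (rule sum.Sigma[symmetric]) auto
      also have "\<dots> = (\<Sum>a\<in>{1..K}. (\<Sum>b | b \<le> N \<and> N < a ^ 2 * b. 1 / real b) / real a ^ 2)"
        by (simp add: sum_divide_distrib mult.commute)
      also have "\<dots> \<le> (\<Sum>a\<in>{1..K}. (1 + 2 * ln (real a)) / real a ^ 2)"
        by (intro sum_mono divide_right_mono sum_inverse_window_le) auto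
      also have "\<dots> \<le> C"
        unfolding C_def using nn by (intro sum_le_suminf summable_ln_over_square) auto
      finally show ?thesis .
    qed
    finally show "(\<Sum>m\<in>F. 1 / real m) \<le> harm N + C" by simp
  qed
  moreover have "C \<ge> 0" unfolding C_def using nn by (intro suminf_nonneg summable_ln_over_square) auto
  ultimately show ?thesis by blast
qed

text \<open>Mertens' upper bound by double counting the pairs \<open>p dvd m\<close> with
  \<open>m \<le> n\<close>, weighted by \<open>ln p\<close>: each \<open>m\<close> receives at most
  the logarithm of its radical, hence at most \<open>ln n\<close>. Rounding in the count of
  multiples costs the factor \<open>K / (K - 1)\<close>.\<close>

lemma sum_ln_prime_over_prime_le:
  fixes z K :: nat
  assumes "z > 0" "K > 1"
  shows "(\<Sum>p | prime p \<and> p \<le> z. ln (real p) / real p) \<le> real K / (real K - 1) * (ln (real z) + ln (real K))"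
proof -
  \<comment> \<open>With this choice every \<open>p \<le> z\<close> has
    \<open>n / p \<ge> K\<close>, so rounding \<open>n / p\<close> down loses at most a fraction
    \<open>1 / K\<close>.\<close>
  define n where "n = K * z"
  have n: "n > 0" using assms by (simp add: n_def)
  let ?P = "{p. prime p \<and> p \<le> z}"
  have fin: "finite ?P" by (rule finite_subset[of _ "{..z}"]) auto
  have "(1 - 1 / real K) * real n * (\<Sum>p\<in>?P. ln (real p) / real p) =
      (\<Sum>p\<in>?P. ln (real p) * ((1 - 1 / real K) * real n / real p))"
    by (simp add: sum_distrib_left mult_ac)
  also have "\<dots> \<le> (\<Sum>p\<in>?P. ln (real p) * real (card {m\<in>{1..n}. p dvd m}))"
  proof (intro sum_mono mult_left_mono)
    fix p assume p: "p \<in> ?P"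
    then have p0: "p > 0" "p \<le> z" by (auto simp: prime_gt_0_nat)
    have "{m\<in>{1..n}. p dvd m} = (\<lambda>i. p * i) ` {1..n div p}"
      using p0 by (auto simp: image_iff less_eq_div_iff_mult_less_eq mult.commute elim!: dvdE)
    then have "card {m\<in>{1..n}. p dvd m} = n div p"
      using p0 by (simp add: card_image inj_on_def)
    moreover have "real n / real p - 1 \<le> real (n div p)"
    proof -
      have "n < p * (n div p + 1)"
        using p0 dividend_less_times_div[of p n] by simp
      then have "real n < real p * (real (n div p) + 1)"
        by (metis of_nat_1 of_nat_add of_nat_less_iff of_nat_mult)
      then show ?thesis using p0 by (simp add: field_simps)
    qed
    moreover have "real n / real p * (1 / real K) \<ge> 1"
      using p0 assms by (simp add: n_def field_simps)
    moreover have "(1 - 1 / real K) * real n / real p = real n / real p - real n / real p * (1 / real K)"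
      by (simp add: left_diff_distrib diff_divide_distrib)
    ultimately show "(1 - 1 / real K) * real n / real p \<le> real (card {m\<in>{1..n}. p dvd m})"
      by linarith
  qed (auto intro!: ln_ge_zero dest: prime_ge_1_nat)
  also have "\<dots> = (\<Sum>p\<in>?P. \<Sum>m\<in>{1..n}. if p dvd m then ln (real p) else 0)"
    by (intro sum.cong) (simp_all add: sum.If_cases Int_def mult.commute)
  also have "\<dots> = (\<Sum>m\<in>{1..n}. \<Sum>p\<in>?P. if p dvd m then ln (real p) else 0)"
    by (rule sum.swap)
  also have "\<dots> \<le> (\<Sum>m\<in>{1..n}. ln (real n))"
  proof (rule sum_mono)
    fix m assume m: "m \<in> {1..n}"
    have "(\<Sum>p\<in>?P. if p dvd m then ln (real p) else 0) = (\<Sum>p\<in>{p\<in>?P. p dvd m}. ln (real p))"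
      using fin by (simp add: sum.If_cases Int_def conj_ac)
    also have "\<dots> \<le> (\<Sum>p\<in>prime_factors m. ln (real p))"
      using m by (intro sum_mono2) (auto simp: prime_factors_dvd prime_ge_1_nat)
    also have "\<dots> = ln (real (\<Prod>(prime_factors m)))"
      by (simp add: ln_prod prime_gt_0_nat in_prime_factors_imp_prime)
    also have "\<dots> \<le> ln (real n)"
    proof -
      have "\<Prod>(prime_factors m) \<in> sqfree_upto n" using m by (intro rad_in_sqfree_upto) auto
      then have "0 < \<Prod>(prime_factors m)" "\<Prod>(prime_factors m) \<le> n" by (auto simp: sqfree_upto_def)
      then show ?thesis by (metis ln_le_cancel_iff n of_nat_0_less_iff of_nat_le_iff)
    qed
    finally show "(\<Sum>p\<in>?P. if p dvd m then ln (real p) else 0) \<le> ln (real n)" .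
  qed
  also have "\<dots> = real n * ln (real n)" by simp
  finally have "(1 - 1 / real K) * (\<Sum>p\<in>?P. ln (real p) / real p) \<le> ln (real n)"
    using n by simp
  also have "ln (real n) = ln (real z) + ln (real K)"
    using assms by (simp add: n_def ln_mult)
  finally show ?thesis using assms by (simp add: field_simps)
qed

text \<open>For \<open>p \<ge> exp (100 * C)\<close> the constant is at most one percent of
  \<open>ln p\<close>, and the finitely many smaller primes go into \<open>C'\<close>. Taking
  \<open>K = 101\<close> in the previous bound gives the slope 1.01 * 1.01 < 1.04.\<close>

lemma sum_ln_prime_plus_const_le:
  fixes C :: real
  assumes "C \<ge> 0"
  shows "\<exists>C'. \<forall>z::nat. z > 0 \<longrightarrow>
    (\<Sum>p | prime p \<and> p \<le> z. (ln (real p) + C) / real p) \<le> 1.04 * ln (real z) + C'"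
proof -
  define w where "w = nat \<lceil>exp (100 * C)\<rceil>"
  define C' where "C' = 1.01 * (101 / 100) * ln 101 + C * (real w + 1)"
  have "(\<Sum>p | prime p \<and> p \<le> z. (ln (real p) + C) / real p) \<le> 1.04 * ln (real z) + C'"
    if z: "z > 0" for z
  proof -
    let ?P = "{p. prime p \<and> p \<le> z}"
    have fin: "finite ?P" by (rule finite_subset[of _ "{..z}"]) auto
    have "(\<Sum>p\<in>?P. (ln (real p) + C) / real p) \<le>
      (\<Sum>p\<in>?P. 1.01 * (ln (real p) / real p) + (if p \<in> {..w} then C else 0))"
    proof (rule sum_mono)
      fix p assume "p \<in> ?P"
      then have p: "p \<ge> 1" by (auto dest: prime_ge_1_nat)
      then have l: "ln (real p) / real p \<ge> 0" by simp
      show "(ln (real p) + C) / real p \<le> 1.01 * (ln (real p) / real p) + (if p \<in> {..w} then C else 0)"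
      proof (cases "p \<le> w")
        case True
        have "C / real p \<le> C" using p assms by (simp add: field_simps mult_left_mono[of 1 "real p" C, simplified])
        then show ?thesis using True l by (simp add: add_divide_distrib)
      next
        case False
        then have "exp (100 * C) \<le> real p" unfolding w_def by linarith
        then have "100 * C \<le> ln (real p)" using p by (simp add: ln_ge_iff)
        then have "C / real p \<le> 0.01 * (ln (real p) / real p)" using p by (simp add: divide_right_mono field_simps)
        then show ?thesis using False by (simp add: add_divide_distrib)
      qed
    qed
    also have "\<dots> = 1.01 * (\<Sum>p\<in>?P. ln (real p) / real p) + (\<Sum>p\<in>?P. if p \<in> {..w} then C else 0)"
      by (simp add: sum.distrib sum_distrib_left)
    also have "(\<Sum>p\<in>?P. if p \<in> {..w} then C else 0) = (\<Sum>p\<in>?P \<inter> {..w}. C)"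
      using fin by (rule sum.inter_restrict[symmetric])
    also have "(\<Sum>p\<in>?P \<inter> {..w}. C) \<le> (\<Sum>p\<in>{..w}. C)"
      using assms by (intro sum_mono2) auto
    also have "(\<Sum>p\<in>{..w}. C) = C * (real w + 1)" by simp
    also have "(\<Sum>p\<in>?P. ln (real p) / real p) \<le> 101 / 100 * (ln (real z) + ln 101)"
      using sum_ln_prime_over_prime_le[of z 101] z by simp
    also have "1.01 * (101 / 100 * (ln (real z) + ln 101)) + C * (real w + 1) \<le> 1.04 * ln (real z) + C'"
      using z by (simp add: C'_def algebra_simps)
    finally show ?thesis by simp
  qed
  then show ?thesis by blast
qed

section \<open>Almost primes in short intervals\<close>

lemma card_multiples_interval:
  fixes d x y :: nat
  assumes "d > 0"
  shows "\<bar>real (card {n\<in>{x<..x+y}. d dvd n}) - real y / real d\<bar> \<le> 1"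
proof -
  have eq: "{n\<in>{x<..x+y}. d dvd n} = (\<lambda>i. d * i) ` {x div d<..(x + y) div d}"
    using assms by (auto simp: image_iff div_less_iff_less_mult less_eq_div_iff_mult_less_eq mult.commute elim!: dvdE)
  have "card {n\<in>{x<..x+y}. d dvd n} = (x + y) div d - x div d"
    unfolding eq using assms by (subst card_image) (auto simp: inj_on_def)
  moreover have "x div d \<le> (x + y) div d" by (simp add: div_le_mono)
  ultimately have c: "real (card {n\<in>{x<..x+y}. d dvd n}) = real ((x + y) div d) - real (x div d)"
    by simp
  have b: "real (m div d) \<le> real m / real d" "real m / real d < real (m div d) + 1" for m
  proof -
    show "real (m div d) \<le> real m / real d" by (rule of_nat_div_le_of_nat)
    have "m < d * (m div d + 1)"
      using assms dividend_less_times_div[of d m] by simp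
    then have "real m < real d * (real (m div d) + 1)"
      by (metis of_nat_1 of_nat_add of_nat_less_iff of_nat_mult)
    then show "real m / real d < real (m div d) + 1" using assms by (simp add: field_simps)
  qed
  have "real (x + y) / real d = real x / real d + real y / real d" by (simp add: add_divide_distrib)
  then show ?thesis unfolding c using b[of x] b[of "x + y"] by linarith
qed

lemma prod_primes_dvd_iff:
  assumes "finite X" "\<And>p. p \<in> X \<Longrightarrow> prime (p::nat)"
  shows "\<Prod>X dvd n \<longleftrightarrow> (\<forall>p\<in>X. p dvd n)"
proof
  assume "\<Prod>X dvd n"
  then show "\<forall>p\<in>X. p dvd n" using assms by (metis dvd_prodI dvd_trans)
next
  assume *: "\<forall>p\<in>X. p dvd n"
  show "\<Prod>X dvd n"
  proof (cases "n = 0")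
    case False
    then have "X \<subseteq> prime_factors n" using * assms by (auto simp: prime_factors_dvd)
    then have "\<Prod>X dvd \<Prod>(prime_factors n)" by (intro prod_dvd_prod_subset) auto
    then show ?thesis using prod_prime_factors_dvd[of n] False dvd_trans by blast
  qed simp
qed

text \<open>Expand the product over the subsets \<open>X\<close> of \<open>S\<close>: each term is a
  constant times the indicator of \<open>\<Prod>X dvd n\<close>, and the interval contains
  \<open>y / \<Prod>X\<close> such \<open>n\<close> up to an error of at most 1. The errors
  recombine to the product on the right.\<close>

lemma sum_prod_local_factors:
  fixes a b :: "nat \<Rightarrow> real" and x y :: nat
  assumes S: "finite S" "\<And>p. p \<in> S \<Longrightarrow> prime p"
  shows "\<bar>(\<Sum>n\<in>{x<..x+y}. \<Prod>p\<in>S. a p + (if p dvd n then b p else 0)) - real y * (\<Prod>p\<in>S. a p + b p / real p)\<bar>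
     \<le> (\<Prod>p\<in>S. \<bar>a p\<bar> + \<bar>b p\<bar>)"
proof -
  let ?A = "{x<..x+y}"
  let ?c = "\<lambda>X. (\<Prod>p\<in>X. b p) * (\<Prod>p\<in>S-X. a p)"
  let ?N = "\<lambda>X. card {n\<in>?A. \<Prod>X dvd n}"
  have fin: "finite X" if "X \<in> Pow S" for X using that S by (auto intro: finite_subset)
  have ind: "(\<Prod>p\<in>X. if p dvd n then b p else 0) = (if \<Prod>X dvd n then \<Prod>p\<in>X. b p else 0)"
    if X: "X \<in> Pow S" for X n
  proof -
    have "\<Prod>X dvd n \<longleftrightarrow> (\<forall>p\<in>X. p dvd n)"
      using X S by (intro prod_primes_dvd_iff fin) auto
    then show ?thesis using fin[OF X] by (auto simp: prod_zero_iff intro: prod.cong)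
  qed
  have "(\<Sum>n\<in>?A. \<Prod>p\<in>S. a p + (if p dvd n then b p else 0)) =
      (\<Sum>n\<in>?A. \<Sum>X\<in>Pow S. (\<Prod>p\<in>X. if p dvd n then b p else 0) * (\<Prod>p\<in>S-X. a p))"
    using S by (simp add: add.commute[of "a _"] prod_add)
  also have "\<dots> = (\<Sum>X\<in>Pow S. \<Sum>n\<in>?A. if \<Prod>X dvd n then ?c X else 0)"
    by (subst sum.swap) (auto intro!: sum.cong simp: ind)
  also have "\<dots> = (\<Sum>X\<in>Pow S. ?c X * real (?N X))"
    by (intro sum.cong refl) (simp add: sum.If_cases Int_def mult.commute)
  finally have 1: "(\<Sum>n\<in>?A. \<Prod>p\<in>S. a p + (if p dvd n then b p else 0)) = (\<Sum>X\<in>Pow S. ?c X * real (?N X))" .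
  have "(\<Prod>p\<in>S. a p + b p / real p) = (\<Sum>X\<in>Pow S. (\<Prod>p\<in>X. b p / real p) * (\<Prod>p\<in>S-X. a p))"
    using S by (simp add: add.commute[of "a _"] prod_add)
  also have "\<dots> = (\<Sum>X\<in>Pow S. ?c X / real (\<Prod>X))"
    by (simp add: prod_dividef)
  finally have 2: "real y * (\<Prod>p\<in>S. a p + b p / real p) = (\<Sum>X\<in>Pow S. ?c X * (real y / real (\<Prod>X)))"
    by (simp add: sum_distrib_left mult_ac)
  have "\<bar>(\<Sum>X\<in>Pow S. ?c X * real (?N X)) - (\<Sum>X\<in>Pow S. ?c X * (real y / real (\<Prod>X)))\<bar>
      = \<bar>\<Sum>X\<in>Pow S. ?c X * (real (?N X) - real y / real (\<Prod>X))\<bar>"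
    by (simp only: sum_subtractf[symmetric] right_diff_distrib)
  also have "\<dots> \<le> (\<Sum>X\<in>Pow S. \<bar>?c X\<bar> * \<bar>real (?N X) - real y / real (\<Prod>X)\<bar>)"
    by (intro order_trans[OF sum_abs]) (simp add: abs_mult)
  also have "\<dots> \<le> (\<Sum>X\<in>Pow S. \<bar>?c X\<bar> * 1)"
  proof (intro sum_mono mult_left_mono)
    fix X assume X: "X \<in> Pow S"
    have "\<Prod>X > 0" using X S by (intro prod_pos) (auto simp: prime_gt_0_nat)
    then show "\<bar>real (?N X) - real y / real (\<Prod>X)\<bar> \<le> 1" by (rule card_multiples_interval)
  qed auto
  also have "\<dots> = (\<Prod>p\<in>S. \<bar>b p\<bar> + \<bar>a p\<bar>)"
    using S by (simp add: prod_add abs_mult abs_prod)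
  finally show ?thesis unfolding 1 2 by (simp add: add.commute)
qed

(* These functions are orthogonal in mean over the integers, with mean square 1 / inv_phi l. The sum of
   inv_phi l * sieve_char l n over squarefree l up to R is Selberg's sieve weight of level R, up to scaling. *)
definition sieve_char :: "nat \<Rightarrow> nat \<Rightarrow> real" where
  "sieve_char l n = (\<Prod>p\<in>prime_factors l. 1 - (if p dvd n then real p else 0))"

lemma prod_union_eq:
  fixes f :: "'a \<Rightarrow> real"
  assumes "finite P" "finite P'"
  shows "prod f P = (\<Prod>p\<in>P' \<union> P. if p \<in> P then f p else 1)"
  using assms by (intro prod.mono_neutral_cong_left) auto

lemma inv_phi_pos: "inv_phi l > 0"
  unfolding inv_phi_def by (intro prod_pos) (auto dest!: in_prime_factors_imp_prime prime_gt_1_nat)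

text \<open>Orthogonality on an interval, restricted to the multiples of all primes in
  \<open>T\<close>. A prime dividing both \<open>l\<close> and \<open>l'\<close> contributes the
  mean \<open>p - 1\<close>, a prime dividing only one of them the mean 0, and a prime of
  \<open>T\<close> the mean \<open>1 / p\<close>. In the applications \<open>T\<close> is empty or a
  single prime.\<close>

lemma sum_sieve_char_pair:
  fixes x y :: nat
  assumes l: "squarefree l" "l > 0" and l': "squarefree l'" "l' > 0"
    and T: "finite T" "\<And>p. p \<in> T \<Longrightarrow> prime p" "T \<inter> prime_factors l = {}" "T \<inter> prime_factors l' = {}"
  shows "\<bar>(\<Sum>n\<in>{x<..x+y}. (if \<forall>q\<in>T. q dvd n then 1 else 0) * (sieve_char l n * sieve_char l' n))
      - (if l = l' then real y / real (\<Prod>T) / inv_phi l else 0)\<bar>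
     \<le> (\<Prod>p\<in>prime_factors l. 1 + real p) * (\<Prod>p\<in>prime_factors l'. 1 + real p)"
proof -
  define P P' where "P = prime_factors l" and "P' = prime_factors l'"
  define S where "S = T \<union> (P \<union> P')"
  \<comment> \<open>The factor at \<open>p\<close> is \<open>a p\<close>, plus \<open>b p\<close>
    when \<open>p dvd n\<close>. For a common prime, \<open>b p\<close> comes from expanding the
    square: (1 - p)^2 = 1 + (p^2 - 2 p).\<close>
  define a b where "a = (\<lambda>p. if p \<in> T then 0 else 1 :: real)"
    and "b = (\<lambda>p. if p \<in> T then 1 else if p \<in> P \<and> p \<in> P' then real p ^ 2 - 2 * real p else - real p)"
  have disj: "T \<inter> P = {}" "T \<inter> P' = {}" using T by (auto simp: P_def P'_def)
  have fin: "finite P" "finite P'" "finite S" "finite T" using T by (auto simp: P_def P'_def S_def)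
  have pr: "prime p" if "p \<in> S" for p using that T by (auto simp: S_def P_def P'_def)
  have ind: "(if \<forall>q\<in>T. q dvd n then 1 else 0) = (\<Prod>q\<in>T. if q dvd n then 1 else 0 :: real)" for n :: nat
    using fin by (auto simp: prod_zero_iff)
  let ?f = "\<lambda>n p. 1 - (if p dvd n then real p else 0)"
  have fact: "(if \<forall>q\<in>T. q dvd n then 1 else 0) * (sieve_char l n * sieve_char l' n)
      = (\<Prod>p\<in>S. a p + (if p dvd n then b p else 0))" for n
  proof -
    have "sieve_char l n = (\<Prod>p\<in>P \<union> P'. if p \<in> P then ?f n p else 1)"
      unfolding sieve_char_def P_def[symmetric] by (subst prod_union_eq[of P P']) (auto simp: fin Un_commute)
    moreover have "sieve_char l' n = (\<Prod>p\<in>P \<union> P'. if p \<in> P' then ?f n p else 1)"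
      unfolding sieve_char_def P'_def[symmetric] by (subst prod_union_eq[of P' P]) (auto simp: fin)
    ultimately have "sieve_char l n * sieve_char l' n =
        (\<Prod>p\<in>P \<union> P'. (if p \<in> P then ?f n p else 1) * (if p \<in> P' then ?f n p else 1))"
      by (simp add: prod.distrib)
    also have "\<dots> = (\<Prod>p\<in>P \<union> P'. a p + (if p dvd n then b p else 0))"
      using disj by (intro prod.cong refl) (auto simp: a_def b_def algebra_simps power2_eq_square)
    finally have 1: "sieve_char l n * sieve_char l' n = (\<Prod>p\<in>P \<union> P'. a p + (if p dvd n then b p else 0))" .
    have 2: "(\<Prod>q\<in>T. if q dvd n then 1 else 0 :: real) = (\<Prod>q\<in>T. a q + (if q dvd n then b q else 0))"
      by (intro prod.cong refl) (auto simp: a_def b_def)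
    show ?thesis unfolding ind 1 2 S_def
      by (rule prod.union_disjoint[symmetric]) (use fin disj in auto)
  qed
  have mean: "real y * (\<Prod>p\<in>S. a p + b p / real p) = (if l = l' then real y / real (\<Prod>T) / inv_phi l else 0)"
  proof (cases "l = l'")
    case True
    then have PP: "P = P'" by (simp add: P_def P'_def)
    have "(\<Prod>p\<in>S. a p + b p / real p) = (\<Prod>p\<in>T. a p + b p / real p) * (\<Prod>p\<in>P. a p + b p / real p)"
      unfolding S_def PP Un_absorb by (rule prod.union_disjoint) (use fin disj in auto)
    also have "(\<Prod>p\<in>T. a p + b p / real p) = 1 / real (\<Prod>T)"
      by (simp add: a_def b_def prod_dividef)
    also have "(\<Prod>p\<in>P. a p + b p / real p) = (\<Prod>p\<in>P. real p - 1)"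
    proof (intro prod.cong refl)
      fix p assume p: "p \<in> P"
      then have "prime p" using pr by (auto simp: S_def)
      then have "p > 0" by (simp add: prime_gt_0_nat)
      then show "a p + b p / real p = real p - 1"
        using p disj PP by (auto simp: a_def b_def field_simps power2_eq_square)
    qed
    also have "(\<Prod>p\<in>P. real p - 1) = 1 / inv_phi l"
      by (simp add: inv_phi_def P_def prod_dividef)
    finally show ?thesis using True by simp
  next
    case False
    then have "P \<noteq> P'" using l l' prod_prime_factors_squarefree unfolding P_def P'_def by metis
    then obtain p where p: "p \<in> P \<union> P'" "\<not> (p \<in> P \<and> p \<in> P')" by blast
    then have pS: "p \<in> S" "p \<notin> T" using disj by (auto simp: S_def)
    then have "p > 0" using pr by (simp add: prime_gt_0_nat)
    then have "a p + b p / real p = 0" using p pS by (auto simp: a_def b_def)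
    then have "(\<Prod>p\<in>S. a p + b p / real p) = 0" using fin pS by (auto simp: prod_zero_iff)
    then show ?thesis using False by simp
  qed
  have "(\<Prod>p\<in>S. \<bar>a p\<bar> + \<bar>b p\<bar>) = (\<Prod>p\<in>T. \<bar>a p\<bar> + \<bar>b p\<bar>) * (\<Prod>p\<in>P \<union> P'. \<bar>a p\<bar> + \<bar>b p\<bar>)"
    unfolding S_def by (rule prod.union_disjoint) (use fin disj in auto)
  also have "(\<Prod>p\<in>T. \<bar>a p\<bar> + \<bar>b p\<bar>) = 1" by (simp add: a_def b_def)
  also have "(\<Prod>p\<in>P \<union> P'. \<bar>a p\<bar> + \<bar>b p\<bar>) \<le>
      (\<Prod>p\<in>P \<union> P'. (if p \<in> P then 1 + real p else 1) * (if p \<in> P' then 1 + real p else 1))"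
  proof (intro prod_mono conjI)
    fix p assume p: "p \<in> P \<union> P'"
    then have "p \<in> S" by (auto simp: S_def)
    then have "real p \<ge> 2" using pr prime_ge_2_nat by fastforce
    then have "real p ^ 2 - 2 * real p \<ge> 0" by (simp add: power2_eq_square)
    then show "\<bar>a p\<bar> + \<bar>b p\<bar> \<le> (if p \<in> P then 1 + real p else 1) * (if p \<in> P' then 1 + real p else 1)"
      using p disj by (auto simp: a_def b_def power2_eq_square algebra_simps)
  qed auto
  also have "\<dots> = (\<Prod>p\<in>P. 1 + real p) * (\<Prod>p\<in>P'. 1 + real p)"
    using prod_union_eq[of P P' "\<lambda>p. 1 + real p"] prod_union_eq[of P' P "\<lambda>p. 1 + real p"] fin
    by (simp add: prod.distrib Un_commute)
  finally have err: "(\<Prod>p\<in>S. \<bar>a p\<bar> + \<bar>b p\<bar>) \<le> (\<Prod>p\<in>P. 1 + real p) * (\<Prod>p\<in>P'. 1 + real p)" by simp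
  show ?thesis
    using order_trans[OF sum_prod_local_factors[OF fin(3) pr, where x=x and y=y and a=a and b=b] err]
    unfolding fact mean P_def P'_def by simp
qed

text \<open>The error in \<open>sum_sieve_char_pair\<close> factors into a part for \<open>l\<close>
  and a part for \<open>l'\<close>, so the weighted errors of all pairs add up to the square of this
  quantity.\<close>

definition sieve_err :: "nat set \<Rightarrow> real" where
  "sieve_err E = (\<Sum>l\<in>E. inv_phi l * (\<Prod>p\<in>prime_factors l. 1 + real p))"

lemma sieve_err_nonneg: "sieve_err E \<ge> 0"
  unfolding sieve_err_def by (intro sum_nonneg mult_nonneg_nonneg prod_nonneg inv_phi_nonneg) auto

lemma sieve_err_mono: "finite F \<Longrightarrow> E \<subseteq> F \<Longrightarrow> sieve_err E \<le> sieve_err F"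
  unfolding sieve_err_def by (intro sum_mono2 mult_nonneg_nonneg prod_nonneg inv_phi_nonneg) auto

text \<open>Expand the square: off the diagonal the means vanish, and on the diagonal
  \<open>inv_phi l ^ 2\<close> meets the mean square \<open>1 / inv_phi l\<close>.\<close>

lemma sum_sieve_square:
  fixes x y :: nat
  assumes E: "finite E" "\<And>l. l \<in> E \<Longrightarrow> squarefree l \<and> l > 0"
    and T: "finite T" "\<And>p. p \<in> T \<Longrightarrow> prime p" "\<And>l. l \<in> E \<Longrightarrow> T \<inter> prime_factors l = {}"
  shows "\<bar>(\<Sum>n\<in>{x<..x+y}. (if \<forall>q\<in>T. q dvd n then 1 else 0) * (\<Sum>l\<in>E. inv_phi l * sieve_char l n) ^ 2)
      - real y / real (\<Prod>T) * (\<Sum>l\<in>E. inv_phi l)\<bar> \<le> sieve_err E ^ 2"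
proof -
  let ?i = "\<lambda>n. if \<forall>q\<in>T. q dvd n then 1 else 0 :: real"
  let ?W = "\<lambda>l. \<Prod>p\<in>prime_factors l. 1 + real p"
  let ?s = "\<lambda>l l'. \<Sum>n\<in>{x<..x+y}. ?i n * (sieve_char l n * sieve_char l' n)"
  let ?m = "\<lambda>l l'. if l = l' then real y / real (\<Prod>T) / inv_phi l else 0"
  have "(\<Sum>n\<in>{x<..x+y}. ?i n * (\<Sum>l\<in>E. inv_phi l * sieve_char l n) ^ 2) =
      (\<Sum>n\<in>{x<..x+y}. \<Sum>l\<in>E. \<Sum>l'\<in>E. inv_phi l * inv_phi l' * (?i n * (sieve_char l n * sieve_char l' n)))"
    unfolding power2_eq_square sum_product by (simp add: sum_distrib_left mult_ac)
  also have "\<dots> = (\<Sum>l\<in>E. \<Sum>l'\<in>E. inv_phi l * inv_phi l' * ?s l l')"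
    by (subst sum.swap, rule sum.cong[OF refl], subst sum.swap) (simp add: sum_distrib_left)
  finally have 1: "(\<Sum>n\<in>{x<..x+y}. ?i n * (\<Sum>l\<in>E. inv_phi l * sieve_char l n) ^ 2) =
      (\<Sum>l\<in>E. \<Sum>l'\<in>E. inv_phi l * inv_phi l' * ?s l l')" .
  have "(\<Sum>l\<in>E. \<Sum>l'\<in>E. inv_phi l * inv_phi l' * ?m l l') = (\<Sum>l\<in>E. \<Sum>l'\<in>E. if l = l' then inv_phi l * (real y / real (\<Prod>T)) else 0)"
    by (intro sum.cong refl) (auto simp: inv_phi_pos less_imp_neq[OF inv_phi_pos, symmetric])
  also have "\<dots> = real y / real (\<Prod>T) * (\<Sum>l\<in>E. inv_phi l)"
    using E by (simp add: sum_distrib_left sum_divide_distrib mult.commute)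
  finally have 2: "real y / real (\<Prod>T) * (\<Sum>l\<in>E. inv_phi l) = (\<Sum>l\<in>E. \<Sum>l'\<in>E. inv_phi l * inv_phi l' * ?m l l')" ..
  have "\<bar>(\<Sum>l\<in>E. \<Sum>l'\<in>E. inv_phi l * inv_phi l' * ?s l l') - (\<Sum>l\<in>E. \<Sum>l'\<in>E. inv_phi l * inv_phi l' * ?m l l')\<bar>
      = \<bar>\<Sum>l\<in>E. \<Sum>l'\<in>E. inv_phi l * inv_phi l' * (?s l l' - ?m l l')\<bar>"
    by (simp only: sum_subtractf[symmetric] right_diff_distrib)
  also have "\<dots> \<le> (\<Sum>l\<in>E. \<Sum>l'\<in>E. \<bar>inv_phi l * inv_phi l' * (?s l l' - ?m l l')\<bar>)"
    by (intro order_trans[OF sum_abs] sum_mono sum_abs)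
  also have "\<dots> \<le> (\<Sum>l\<in>E. \<Sum>l'\<in>E. inv_phi l * inv_phi l' * (?W l * ?W l'))"
  proof (intro sum_mono)
    fix l l' assume "l \<in> E" "l' \<in> E"
    then have "\<bar>?s l l' - ?m l l'\<bar> \<le> ?W l * ?W l'"
      using E T by (intro sum_sieve_char_pair) auto
    then show "\<bar>inv_phi l * inv_phi l' * (?s l l' - ?m l l')\<bar> \<le> inv_phi l * inv_phi l' * (?W l * ?W l')"
      by (simp add: abs_mult inv_phi_nonneg mult_left_mono)
  qed
  also have "\<dots> = sieve_err E ^ 2"
    unfolding sieve_err_def power2_eq_square sum_product by (simp add: mult_ac)
  finally show ?thesis unfolding 1 2 .
qed

(* On multiples of q the terms l and q l cancel, so only those l survive for which q l exceeds the level R. *)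
lemma sieve_sum_multiple:
  assumes q: "prime q" "q dvd n"
  shows "(\<Sum>l\<in>sqfree_upto R. inv_phi l * sieve_char l n) =
    (\<Sum>l\<in>{l\<in>sqfree_upto R. \<not> q dvd l \<and> R < q * l}. inv_phi l * sieve_char l n)"
proof -
  let ?D = "sqfree_upto R"
  let ?f = "\<lambda>l. inv_phi l * sieve_char l n"
  let ?A = "{l\<in>?D. q dvd l}" and ?B = "{l\<in>?D. \<not> q dvd l \<and> q * l \<le> R}" and ?C = "{l\<in>?D. \<not> q dvd l \<and> R < q * l}"
  have q1: "q > 1" using q prime_gt_1_nat by blast
  \<comment> \<open>A squarefree multiple of \<open>q\<close> is \<open>q\<close> times a squarefree
    number not divisible by \<open>q\<close>, so multiplication by \<open>q\<close> matches
    \<open>?B\<close> with \<open>?A\<close>.\<close>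
  have AB: "?A = (\<lambda>l. q * l) ` ?B"
  proof (intro equalityI subsetI)
    fix l assume l: "l \<in> ?A"
    then obtain m where m: "l = q * m" by auto
    have "squarefree (q * m)" "m > 0" using l m by (auto simp: sqfree_upto_def)
    then have "squarefree m" "\<not> q dvd m"
      using q1 squarefreeD[of "q * m" q] by (auto simp: power2_eq_square dest: squarefree_multD)
    moreover have "m \<le> q * m" using q1 by simp
    moreover have "q * m \<le> R" using l m by (simp add: sqfree_upto_def)
    moreover from calculation have "m \<le> R" by linarith
    ultimately have "m \<in> ?B" using \<open>m > 0\<close> by (simp add: sqfree_upto_def)
    then show "l \<in> (\<lambda>l. q * l) ` ?B" using m by blast
  next
    fix l assume "l \<in> (\<lambda>l. q * l) ` ?B"
    then obtain m where m: "l = q * m" "m \<in> ?B" by auto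
    then have "coprime q m" using q by (simp add: prime_imp_coprime)
    then show "l \<in> ?A" using m q by (auto simp: sqfree_upto_def squarefree_mult_coprime squarefree_prime prime_gt_0_nat)
  qed
  \<comment> \<open>Since \<open>q dvd n\<close>, the new prime multiplies \<open>sieve_char\<close>
    by \<open>1 - q\<close> and \<open>inv_phi\<close> by \<open>1 / (q - 1)\<close>; hence the sign
    change.\<close>
  have neg: "?f (q * l) = - ?f l" if l: "l \<in> ?B" for l
  proof -
    have l0: "l > 0" "\<not> q dvd l" using l by (auto simp: sqfree_upto_def)
    have pf: "prime_factors (q * l) = insert q (prime_factors l)"
      using q l0 q1 by (simp add: prime_factors_product prime_prime_factors)
    have "q \<notin> prime_factors l" using l0 by auto
    then have "inv_phi (q * l) = inv_phi l / (real q - 1)" "sieve_char (q * l) n = (1 - real q) * sieve_char l n"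
      using q by (simp_all add: inv_phi_def sieve_char_def pf)
    then have "?f (q * l) = (1 - real q) / (real q - 1) * ?f l" by simp
    also have "(1 - real q) / (real q - 1) = - 1" using q1 by (simp add: field_simps)
    finally show ?thesis by simp
  qed
  have "?D = ?A \<union> (?B \<union> ?C)" by auto
  moreover have "sum ?f (?A \<union> (?B \<union> ?C)) = sum ?f ?A + (sum ?f ?B + sum ?f ?C)"
    by (subst sum.union_disjoint, auto)+ 
  moreover have "sum ?f ?A = (\<Sum>l\<in>?B. ?f (q * l))"
    unfolding AB using q1 by (subst sum.reindex) (auto simp: inj_on_def)
  moreover have "\<dots> = - sum ?f ?B"
    by (simp add: neg sum_negf)
  ultimately show ?thesis by simp
qed

text \<open>If every \<open>n\<close> of the interval has a prime factor up to \<open>z\<close>,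
  then summing the weights of the multiples of \<open>q\<close> over all primes
  \<open>q \<le> z\<close> counts each weight at least once. \<open>sum_sieve_square\<close>
  evaluates both the total weight and the weight on the multiples of \<open>q\<close>, with at most
  \<open>z + 1\<close> error terms altogether.\<close>

lemma sieve_inequality:
  fixes x y R z :: nat
  assumes no: "\<And>n. n \<in> {x<..x+y} \<Longrightarrow> \<exists>q. prime q \<and> q \<le> z \<and> q dvd n"
  shows "real y * inv_phi_sum R \<le> real y * (\<Sum>q | prime q \<and> q \<le> z. (inv_phi_sum R - inv_phi_sum (R div q)) / real q)
     + (real z + 1) * sieve_err (sqfree_upto R) ^ 2"
proof -
  let ?D = "sqfree_upto R" and ?A = "{x<..x+y}" and ?P = "{q. prime q \<and> q \<le> z}"
  let ?E = "\<lambda>q. {l\<in>sqfree_upto R. \<not> q dvd l \<and> R < q * l}"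
  let ?L = "\<lambda>n. \<Sum>l\<in>?D. inv_phi l * sieve_char l n"
  let ?err = "sieve_err ?D ^ 2"
  have fin: "finite ?P" by (rule finite_subset[of _ "{..z}"]) auto
  have D: "squarefree l \<and> l > 0" if "l \<in> ?D" for l using that by (simp add: sqfree_upto_def)
  have "real y * inv_phi_sum R - ?err \<le> (\<Sum>n\<in>?A. ?L n ^ 2)"
    using sum_sieve_square[of ?D "{}", where x=x and y=y, OF finite_sqfree_upto D] unfolding inv_phi_sum_def
    by (simp add: abs_le_iff)
  also have "\<dots> \<le> (\<Sum>n\<in>?A. \<Sum>q\<in>?P. (if q dvd n then 1 else 0) * ?L n ^ 2)"
  proof (rule sum_mono)
    fix n assume "n \<in> ?A"
    then obtain q where q: "q \<in> ?P" "q dvd n" using no by blast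
    then have "?L n ^ 2 = (if q dvd n then 1 else 0) * ?L n ^ 2" by simp
    also have "\<dots> \<le> (\<Sum>q\<in>?P. (if q dvd n then 1 else 0) * ?L n ^ 2)"
      using fin q by (intro member_le_sum) auto
    finally show "?L n ^ 2 \<le> (\<Sum>q\<in>?P. (if q dvd n then 1 else 0) * ?L n ^ 2)" .
  qed
  also have "\<dots> = (\<Sum>q\<in>?P. \<Sum>n\<in>?A. (if q dvd n then 1 else 0) * ?L n ^ 2)"
    by (rule sum.swap)
  also have "\<dots> \<le> (\<Sum>q\<in>?P. real y * ((inv_phi_sum R - inv_phi_sum (R div q)) / real q) + ?err)"
  proof (rule sum_mono)
    fix q assume "q \<in> ?P"
    then have q: "prime q" "q > 0" by (auto simp: prime_gt_0_nat)
    have finE: "finite (?E q)" by (rule finite_subset[of _ ?D]) auto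
    have "(\<Sum>n\<in>?A. (if q dvd n then 1 else 0) * ?L n ^ 2) =
        (\<Sum>n\<in>?A. (if q dvd n then 1 else 0) * (\<Sum>l\<in>?E q. inv_phi l * sieve_char l n) ^ 2)"
      using q by (intro sum.cong refl) (auto simp: sieve_sum_multiple)
    also have "\<dots> \<le> real y / real q * (\<Sum>l\<in>?E q. inv_phi l) + sieve_err (?E q) ^ 2"
    proof -
      have "squarefree l \<and> l > 0" "{q} \<inter> prime_factors l = {}" if "l \<in> ?E q" for l
        using that D by auto
      then show ?thesis
        using sum_sieve_square[of "?E q" "{q}", where x=x and y=y, OF finE] q by (simp add: abs_le_iff)
    qed
    also have "sieve_err (?E q) ^ 2 \<le> ?err"
      by (intro power_mono sieve_err_mono sieve_err_nonneg) auto
    also have "(\<Sum>l\<in>?E q. inv_phi l) \<le> inv_phi_sum R - inv_phi_sum (R div q)"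
    proof -
      \<comment> \<open>The surviving \<open>l\<close> satisfy \<open>R < q * l\<close>, that is
        \<open>l > R div q\<close>, which bounds their sum by a difference of two values of
        \<open>inv_phi_sum\<close>.\<close>
      have "?E q \<subseteq> ?D - sqfree_upto (R div q)"
        using q by (auto simp: sqfree_upto_def less_eq_div_iff_mult_less_eq mult.commute)
      then have "(\<Sum>l\<in>?E q. inv_phi l) \<le> (\<Sum>l\<in>?D - sqfree_upto (R div q). inv_phi l)"
        by (intro sum_mono2) (auto simp: inv_phi_nonneg)
      also have "\<dots> = inv_phi_sum R - inv_phi_sum (R div q)"
        unfolding inv_phi_sum_def
        by (intro sum_diff) (auto simp: sqfree_upto_def intro: order_trans[OF _ div_le_dividend])
      finally show ?thesis .
    qed
    finally show "(\<Sum>n\<in>?A. (if q dvd n then 1 else 0) * ?L n ^ 2)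
        \<le> real y * ((inv_phi_sum R - inv_phi_sum (R div q)) / real q) + ?err"
      by (simp add: mult_left_mono divide_right_mono)
  qed
  also have "\<dots> = real y * (\<Sum>q\<in>?P. (inv_phi_sum R - inv_phi_sum (R div q)) / real q) + real (card ?P) * ?err"
    by (simp add: sum.distrib sum_distrib_left)
  also have "real (card ?P) * ?err \<le> real z * ?err"
  proof (intro mult_right_mono of_nat_mono)
    have "?P \<subseteq> {1..z}" by (auto dest: prime_ge_1_nat)
    then show "card ?P \<le> z" using card_mono[of "{1..z}" ?P] by simp
  qed auto
  finally show ?thesis by (simp add: algebra_simps)
qed

text \<open>The i-th smallest element of \<open>P\<close> is at least i + 1, so the product is
  dominated by the telescoping product of (i + 1) / i. The induction adds the largest element
  last.\<close>

lemma prod_ratio_le_card: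
  assumes "finite P" "\<And>p. p \<in> P \<Longrightarrow> p \<ge> (2::nat)"
  shows "(\<Prod>p\<in>P. real p / (real p - 1)) \<le> real (card P) + 1"
  using assms
proof (induction P rule: finite_linorder_max_induct)
  case (insert b A)
  have A1: "Suc 0 \<le> a" if "a \<in> A" for a using insert(4)[of a] that by simp
  have "insert b A \<subseteq> {2..b}" using insert by (force intro: less_imp_le)
  then have "card (insert b A) \<le> card {2..b}" by (intro card_mono) auto
  then have "card A + 2 \<le> b" using insert by (auto simp: card_insert_if)
  then have b: "real (card A) + 2 \<le> real b" by linarith
  then have "real b / (real b - 1) \<le> (real (card A) + 2) / (real (card A) + 1)"
    by (simp add: divide_simps) (simp add: algebra_simps)
  then have "real b / (real b - 1) * (\<Prod>p\<in>A. real p / (real p - 1))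
      \<le> (real (card A) + 2) / (real (card A) + 1) * (real (card A) + 1)"
    using insert A1 by (intro mult_mono) (auto intro!: prod_nonneg divide_nonneg_nonneg)
  also have "\<dots> = real (card (insert b A)) + 1" using insert by (auto simp: add_eq_0_iff)
  finally show ?case using insert by auto
qed simp

text \<open>Each term is a product of \<open>(p + 1) / (p - 1)\<close>, at most the square of the
  product of \<open>p / (p - 1)\<close>, hence polynomial in the number of prime factors of
  \<open>l\<close>. That number is at most \<open>log 2 R\<close>, because these primes are at least
  2 and multiply to \<open>l \<le> R\<close>.\<close>

lemma sieve_err_le:
  assumes "R > 0"
  shows "sieve_err (sqfree_upto R) \<le> real R * (log 2 (real R) + 1) ^ 2"
proof -
  have "sieve_err (sqfree_upto R) \<le> (\<Sum>l\<in>sqfree_upto R. (log 2 (real R) + 1) ^ 2)"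
    unfolding sieve_err_def
  proof (rule sum_mono)
    fix l assume l: "l \<in> sqfree_upto R"
    let ?P = "prime_factors l"
    have ge2: "p \<ge> 2" if "p \<in> ?P" for p using that by (auto dest!: in_prime_factors_imp_prime prime_ge_2_nat)
    have "inv_phi l * (\<Prod>p\<in>?P. 1 + real p) = (\<Prod>p\<in>?P. (1 + real p) / (real p - 1))"
      by (simp add: inv_phi_def prod.distrib[symmetric])
    also have "\<dots> \<le> (\<Prod>p\<in>?P. (real p / (real p - 1)) ^ 2)"
    proof (intro prod_mono conjI)
      fix p assume "p \<in> ?P"
      then have p: "real p \<ge> 2" using ge2 by fastforce
      then show "0 \<le> (1 + real p) / (real p - 1)" by simp
      have "(1 + real p) * (real p - 1) \<le> real p ^ 2" by (simp add: algebra_simps power2_eq_square)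
      then have "(1 + real p) * (real p - 1) / (real p - 1) ^ 2 \<le> real p ^ 2 / (real p - 1) ^ 2"
        by (intro divide_right_mono) auto
      then show "(1 + real p) / (real p - 1) \<le> (real p / (real p - 1)) ^ 2"
        using p by (simp add: power_divide power2_eq_square)
    qed
    also have "\<dots> = (\<Prod>p\<in>?P. real p / (real p - 1)) ^ 2"
      by (simp add: prod_power_distrib)
    also have "\<dots> \<le> (real (card ?P) + 1) ^ 2"
      using ge2 by (intro power_mono prod_ratio_le_card prod_nonneg divide_nonneg_nonneg) (force+)
    also have "\<dots> \<le> (log 2 (real R) + 1) ^ 2"
    proof -
      have "2 ^ card ?P = (\<Prod>p\<in>?P. 2::nat)" by simp
      also have "\<dots> \<le> \<Prod>?P" using ge2 by (intro prod_mono) auto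
      also have "\<dots> = l" using l by (intro prod_prime_factors_squarefree) (auto simp: sqfree_upto_def)
      also have "l \<le> R" using l by (auto simp: sqfree_upto_def)
      finally have "real (2 ^ card ?P) \<le> real R" by (rule of_nat_mono)
      then have "real (card ?P) \<le> log 2 (real R)" using assms by (simp add: le_log_iff powr_realpow)
      then show ?thesis by (intro power_mono) auto
    qed
    finally show "inv_phi l * (\<Prod>p\<in>?P. 1 + real p) \<le> (log 2 (real R) + 1) ^ 2" .
  qed
  also have "\<dots> = real (card (sqfree_upto R)) * (log 2 (real R) + 1) ^ 2" by simp
  also have "\<dots> \<le> real R * (log 2 (real R) + 1) ^ 2"
  proof (intro mult_right_mono of_nat_mono)
    have "sqfree_upto R \<subseteq> {1..R}" by (auto simp: sqfree_upto_def)
    then show "card (sqfree_upto R) \<le> R" using card_mono[of "{1..R}" "sqfree_upto R"] by simp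
  qed auto
  finally show ?thesis .
qed

(* The exponent 0.2375 only has to stay below 1/4: with level R = X^(1/4) the main term is proportional to
   ln R - ln z > 0 and the error z R^2 is smaller than the length X^0.7625 of the interval. *)
lemma almost_prime_in_short_interval:
  "\<exists>X0. \<forall>X\<ge>X0. \<exists>N::nat. X \<le> real N \<and> real N \<le> X + X powr 0.7625 \<and>
     (\<forall>p. prime p \<longrightarrow> p dvd N \<longrightarrow> real p > X powr 0.2375)"
proof -
  obtain C where C: "C \<ge> 0" "\<And>N. inv_phi_sum N \<le> harm N + C" using inv_phi_sum_le by blast
  obtain C' where C': "\<And>z::nat. z > 0 \<Longrightarrow>
    (\<Sum>p | prime p \<and> p \<le> z. (ln (real p) + (C + 1)) / real p) \<le> 1.04 * ln (real z) + C'"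
    using sum_ln_prime_plus_const_le[of "C + 1"] C by auto
  \<comment> \<open>This inequality will contradict the sieve. Here
    \<open>0.003 = 0.25 - 1.04 * 0.2375\<close> is the slope left over in the main term, and the
    right side has order \<open>X powr 0.7375\<close> up to logarithms, below the interval length
    \<open>X powr 0.7625\<close>.\<close>
  have "eventually (\<lambda>X::real. (X powr 0.7625 - 2) * (0.003 * ln X - C') >
      (X powr 0.2375 + 1) * (X powr 0.25 * (log 2 X + 1) ^ 2) ^ 2) at_top"
    by real_asymp
  moreover have "eventually (\<lambda>X::real. X powr 0.7625 > 3) at_top" by real_asymp
  moreover have "eventually (\<lambda>X::real. 0.003 * ln X - C' > 0) at_top" by real_asymp
  moreover have "eventually (\<lambda>X::real. X > 1) at_top" by real_asymp
  ultimately have "eventually (\<lambda>X::real. (X powr 0.7625 - 2) * (0.003 * ln X - C') >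
      (X powr 0.2375 + 1) * (X powr 0.25 * (log 2 X + 1) ^ 2) ^ 2 \<and> X powr 0.7625 > 3 \<and>
      0.003 * ln X - C' > 0 \<and> X > 1) at_top"
    by eventually_elim auto
  then obtain X0 where X0: "\<And>X. X \<ge> X0 \<Longrightarrow> (X powr 0.7625 - 2) * (0.003 * ln X - C') >
      (X powr 0.2375 + 1) * (X powr 0.25 * (log 2 X + 1) ^ 2) ^ 2 \<and> X powr 0.7625 > 3 \<and>
      0.003 * ln X - C' > 0 \<and> X > 1"
    unfolding eventually_at_top_linorder by blast
  have "\<exists>N::nat. X \<le> real N \<and> real N \<le> X + X powr 0.7625 \<and>
     (\<forall>p. prime p \<longrightarrow> p dvd N \<longrightarrow> real p > X powr 0.2375)" if X: "X \<ge> X0" for X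
  proof -
    note * = X0[OF X]
    define x where "x = nat \<lceil>X\<rceil>"
    \<comment> \<open>One unit of the length is given up for rounding \<open>X\<close> up to
      \<open>x\<close>.\<close>
    define y where "y = nat \<lfloor>X powr 0.7625 - 1\<rfloor>"
    define z where "z = nat \<lfloor>X powr 0.2375\<rfloor>"
    define R where "R = nat \<lfloor>X powr 0.25\<rfloor>"
    have x: "X \<le> real x" "real x \<le> X + 1" using * unfolding x_def by linarith+
    have y: "X powr 0.7625 - 2 \<le> real y" "real y \<le> X powr 0.7625 - 1" using * unfolding y_def by linarith+
    have z1: "X powr 0.2375 \<ge> 1" and R1: "X powr 0.25 \<ge> 1" using * by (simp_all add: ge_one_powr_ge_zero)
    have z: "real z \<le> X powr 0.2375" "X powr 0.2375 < real z + 1" "z > 0" using z1 unfolding z_def by linarith+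
    have R: "real R \<le> X powr 0.25" "X powr 0.25 < real R + 1" "R > 0" using R1 unfolding R_def by linarith+
    have "\<exists>n\<in>{x<..x+y}. \<forall>q. prime q \<longrightarrow> q dvd n \<longrightarrow> q > z"
    proof (rule ccontr)
      assume "\<not> ?thesis"
      then have "\<exists>q. prime q \<and> q \<le> z \<and> q dvd n" if "n \<in> {x<..x+y}" for n
        using that by (meson not_le_imp_less)
      then have ineq: "real y * inv_phi_sum R \<le> real y * (\<Sum>q | prime q \<and> q \<le> z. (inv_phi_sum R - inv_phi_sum (R div q)) / real q)
         + (real z + 1) * sieve_err (sqfree_upto R) ^ 2"
        by (rule sieve_inequality)
      have "(\<Sum>q | prime q \<and> q \<le> z. (inv_phi_sum R - inv_phi_sum (R div q)) / real q)
          \<le> (\<Sum>q | prime q \<and> q \<le> z. (ln (real q) + (C + 1)) / real q)"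
      proof (intro sum_mono divide_right_mono)
        fix q assume "q \<in> {q. prime q \<and> q \<le> z}"
        then have q: "q > 0" by (auto simp: prime_gt_0_nat)
        \<comment> \<open>The upper bound \<open>ln R + 1 + C\<close> for
          \<open>inv_phi_sum R\<close> and the lower bound \<open>ln (R div q + 1)\<close> for the
          other value differ by at most \<open>ln q + C + 1\<close>.\<close>
        have "harm R - ln (real R) \<le> harm 1 - ln (real 1)"
          using R by (intro euler_mascheroni_sequence_decreasing) auto
        then have 1: "inv_phi_sum R \<le> ln (real R) + 1 + C" using C(2)[of R] by (simp add: harm_def)
        have "R < q * (R div q + 1)"
          using q dividend_less_times_div[of q R] by simp
        then have "real R < real q * (real (R div q) + 1)"
          by (metis of_nat_1 of_nat_add of_nat_less_iff of_nat_mult)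
        then have "ln (real R) \<le> ln (real q * (real (R div q) + 1))"
          using R by (subst ln_le_cancel_iff) auto
        also have "\<dots> = ln (real q) + ln (real (R div q) + 1)"
          using q by (subst ln_mult) auto
        also have "ln (real (R div q) + 1) \<le> inv_phi_sum (R div q)"
          using ln_le_harm harm_le_inv_phi_sum order_trans by blast
        finally show "inv_phi_sum R - inv_phi_sum (R div q) \<le> ln (real q) + (C + 1)" using 1 by linarith
      qed auto
      also have "\<dots> \<le> 1.04 * ln (real z) + C'" using z by (intro C')
      also have "ln (real z) \<le> 0.2375 * ln X"
      proof -
        have "ln (real z) \<le> ln (X powr 0.2375)" using z * by (subst ln_le_cancel_iff) auto
        then show ?thesis using * by (simp add: ln_powr)
      qed
      finally have 1: "(\<Sum>q | prime q \<and> q \<le> z. (inv_phi_sum R - inv_phi_sum (R div q)) / real q) \<le> 0.247 * ln X + C'"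
        by simp
      have 2: "0.25 * ln X \<le> inv_phi_sum R"
      proof -
        have "0.25 * ln X = ln (X powr 0.25)" using * by (simp add: ln_powr)
        also have "\<dots> \<le> ln (real R + 1)" using R * by (subst ln_le_cancel_iff) auto
        also have "\<dots> \<le> inv_phi_sum R" using ln_le_harm harm_le_inv_phi_sum order_trans by blast
        finally show ?thesis .
      qed
      have "(X powr 0.7625 - 2) * (0.003 * ln X - C') \<le> real y * (0.003 * ln X - C')"
        using y * by (intro mult_right_mono) auto
      also have "\<dots> \<le> real y * (inv_phi_sum R - (\<Sum>q | prime q \<and> q \<le> z. (inv_phi_sum R - inv_phi_sum (R div q)) / real q))"
        using 1 2 by (intro mult_left_mono) auto
      also have "\<dots> \<le> (real z + 1) * sieve_err (sqfree_upto R) ^ 2"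
        using ineq by (simp add: right_diff_distrib)
      also have "\<dots> \<le> (X powr 0.2375 + 1) * (X powr 0.25 * (log 2 X + 1) ^ 2) ^ 2"
      proof (intro mult_mono power_mono sieve_err_nonneg)
        have "X powr 0.25 \<le> X powr 1" using * by (intro powr_mono) auto
        then have "log 2 (real R) \<le> log 2 X" using R * by simp
        moreover have "log 2 (real R) \<ge> 0" using R by simp
        ultimately have "real R * (log 2 (real R) + 1) ^ 2 \<le> X powr 0.25 * (log 2 X + 1) ^ 2"
          using R by (intro mult_mono power_mono) auto
        then show "sieve_err (sqfree_upto R) \<le> X powr 0.25 * (log 2 X + 1) ^ 2"
          using sieve_err_le[of R] R by linarith
      qed (use z in auto)
      finally show False using * by linarith
    qed
    then obtain n where n: "n \<in> {x<..x+y}" "\<And>q. prime q \<Longrightarrow> q dvd n \<Longrightarrow> q > z" by blast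
    have "real p > X powr 0.2375" if "prime p" "p dvd n" for p
      using n(2)[OF that] z by linarith
    moreover have "X \<le> real n" "real n \<le> X + X powr 0.7625" using n x y by auto
    ultimately show ?thesis by blast
  qed
  then show ?thesis by blast
qed

section \<open>Bounds for radius sequences\<close>

text \<open>Each ordered pair of distinct letters can be read off from the earlier of two positions,
  their distance between 1 and \<open>k\<close>, and an orientation.\<close>

lemma radius_sequence_pair_count:
  assumes "radius_sequence k {..<n} xs"
  shows "n * (n - 1) \<le> 2 * k * length xs"
proof -
  let ?L = "length xs"
  \<comment> \<open>\<open>?g\<close> may read past the end of the list; this only enlarges an image
    whose cardinality is bounded from above.\<close>
  let ?g = "\<lambda>((i, d), s). if s then (xs ! i, xs ! (i + d)) else (xs ! (i + d), xs ! i)"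
  let ?D = "({..<?L} \<times> {1..k}) \<times> (UNIV :: bool set)"
  have "{(a, b). a < n \<and> b < n \<and> a \<noteq> b} \<subseteq> ?g ` ?D"
  proof (clarify)
    fix a b assume ab: "a < n" "b < n" "a \<noteq> b"
    then obtain i j where ij: "i < ?L" "j < ?L" "xs ! i = a" "xs ! j = b" "\<bar>int i - int j\<bar> \<le> int k"
      using assms unfolding radius_sequence_def by blast
    have "i \<noteq> j" using ij ab by auto
    then consider "i < j" | "j < i" by linarith
    then show "(a, b) \<in> ?g ` ?D"
    proof cases
      case 1
      then show ?thesis using ij by (intro image_eqI[of _ _ "((i, j - i), True)"]) auto
    next
      case 2
      then show ?thesis using ij by (intro image_eqI[of _ _ "((j, i - j), False)"]) auto
    qed
  qed
  then have "card {(a, b). a < n \<and> b < n \<and> a \<noteq> b} \<le> card (?g ` ?D)"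
    by (rule card_mono[rotated]) auto
  also have "\<dots> \<le> card ?D" by (rule card_image_le) auto
  also have "card ?D = 2 * k * ?L" by (simp add: card_cartesian_product)
  also have "{(a, b). a < n \<and> b < n \<and> a \<noteq> b} = Sigma {..<n} (\<lambda>a. {..<n} - {a})" by auto
  then have "card {(a, b). a < n \<and> b < n \<and> a \<noteq> b} = n * (n - 1)" by simp
  finally show ?thesis .
qed

lemma min_radius_length_lower:
  assumes "k > 0"
  shows "n * (n - 1) \<le> 2 * k * min_radius_length k n"
proof -
  obtain xs where xs: "radius_sequence k {..<n} xs" "length xs = min_radius_length k n"
    using min_radius_length_attained[OF assms] by blast
  show ?thesis using radius_sequence_pair_count[OF xs(1)] xs(2) by simp
qed

lemma min_radius_length_le:
  assumes "radius_sequence k A xs" "finite A" "0 < n" "n \<le> card A"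
  shows "min_radius_length k n \<le> length xs"
proof -
  obtain h where h: "bij_betw h A {..<card A}"
    using ex_bij_betw_finite_nat[OF assms(2)] by (auto simp: atLeast0LessThan)
  \<comment> \<open>Surplus letters of \<open>A\<close> are merged into the letter 0, which exists
    as \<open>n > 0\<close>; a surjective relabelling keeps the radius property.\<close>
  define g where "g = (\<lambda>a. if h a < n then h a else 0)"
  have "g ` A = {..<n}"
  proof (intro equalityI subsetI)
    fix m assume m: "m \<in> {..<n}"
    then have "m \<in> h ` A" using h assms by (auto simp: bij_betw_def)
    then show "m \<in> g ` A" using m by (auto simp: g_def image_iff)
  qed (use assms in \<open>auto simp: g_def\<close>)
  then have "radius_sequence k {..<n} (map g xs)"
    using assms by (intro radius_sequence_map)
  then show ?thesis unfolding min_radius_length_def by (intro Least_le) auto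
qed

section \<open>Pairs of letters within distance \<open>k\<close>, and a crude upper bound\<close>

definition near :: "nat \<Rightarrow> 'a list \<Rightarrow> 'a \<Rightarrow> 'a \<Rightarrow> bool" where
  "near k xs a b \<longleftrightarrow> (\<exists>i<length xs. \<exists>j<length xs. xs ! i = a \<and> xs ! j = b \<and> \<bar>int i - int j\<bar> \<le> int k)"

lemma radius_sequence_near:
  "radius_sequence k A xs \<longleftrightarrow> set xs \<subseteq> A \<and> (\<forall>a\<in>A. \<forall>b\<in>A. near k xs a b)"
  unfolding radius_sequence_def near_def ..

lemma nearI:
  "i < length xs \<Longrightarrow> j < length xs \<Longrightarrow> xs ! i = a \<Longrightarrow> xs ! j = b \<Longrightarrow> \<bar>int i - int j\<bar> \<le> int k \<Longrightarrow> near k xs a b"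
  unfolding near_def by blast

lemma nearE:
  assumes "near k xs a b"
  obtains i j where "i < length xs" "j < length xs" "xs ! i = a" "xs ! j = b" "\<bar>int i - int j\<bar> \<le> int k"
  using assms unfolding near_def by blast

lemma near_sym:
  assumes "near k xs a b"
  shows "near k xs b a"
  using assms by (rule nearE) (rule nearI, assumption+, linarith)

lemma near_append:
  assumes "near k ys a b"
  shows "near k (us @ ys @ vs) a b"
  using assms
proof (rule nearE)
  fix i j assume "i < length ys" "j < length ys" "ys ! i = a" "ys ! j = b" "\<bar>int i - int j\<bar> \<le> int k"
  then show ?thesis
    by (intro nearI[of "length us + i" _ "length us + j"]) (simp_all add: nth_append)
qed

lemma near_concat:
  assumes "near k ys a b" "ys \<in> set yss"
  shows "near k (concat yss) a b"
proof -
  obtain us vs where "yss = us @ ys # vs" using assms by (meson split_list)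
  then show ?thesis using near_append[OF assms(1)] by simp
qed

lemma near_map:
  assumes "near k xs a b"
  shows "near k (map f xs) (f a) (f b)"
  using assms by (rule nearE) (rule nearI, simp_all)

lemma near_upt:
  assumes "t < L" "t' < L" "\<bar>int t - int t'\<bar> \<le> int k"
  shows "near k (map F [0..<L]) (F t) (F t')"
  using assms by (intro nearI[of t _ t']) simp_all

lemma mult_add_less:
  assumes "(c::nat) < M" "u < w"
  shows "c * w + u < M * w"
proof -
  have "Suc c * w \<le> M * w" using assms by (intro mult_le_mono1) simp
  then show ?thesis using assms by simp
qed

text \<open>Cut the alphabet into \<open>M\<close> blocks of \<open>h\<close>, about
  \<open>k / 2\<close>, letters and write down all \<open>M ^ 2\<close> ordered pairs of blocks one
  after the other. Two letters meet in the stretch of their pair of blocks, which has only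
  \<open>2 * h \<le> k + 1\<close> positions.\<close>

lemma min_radius_length_crude:
  assumes "k > 0" "v > 0"
  shows "real (min_radius_length k v) \<le> 4 * real v ^ 2 / real k + 4 * real v + real k + 1"
proof -
  define h where "h = (k + 1) div 2"
  define M where "M = v div h + 1"
  have h: "h > 0" "2 * h \<le> k + 1" "k \<le> 2 * h" using assms by (auto simp: h_def)
  have M: "M > 0" by (simp add: M_def)
  \<comment> \<open>Position \<open>t\<close> lies in stretch \<open>c\<close>, which encodes the
    pair of blocks \<open>(c div M, c mod M)\<close>; the first half of the stretch lists the first
    block, the second half the other one.\<close>
  define F where "F = (\<lambda>t. let c = t div (2 * h); u = t mod (2 * h) in
    if u < h then (c div M) * h + u else (c mod M) * h + (u - h))"
  define xs where "xs = map F [0..<M * M * (2 * h)]"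
  have "radius_sequence k {..<M * h} xs"
    unfolding radius_sequence_near
  proof (intro conjI ballI subsetI)
    fix a assume "a \<in> set xs"
    then obtain t where t: "a = F t" "t < M * M * (2 * h)" by (auto simp: xs_def)
    have c: "t div (2 * h) < M * M" using t h by (simp add: div_less_iff_less_mult)
    then have "t div (2 * h) div M < M" "t div (2 * h) mod M < M"
      using M by (simp_all add: div_less_iff_less_mult)
    moreover have "t mod (2 * h) < 2 * h" using h by simp
    moreover have "t mod (2 * h) - h < h" using calculation(3) h by linarith
    ultimately show "a \<in> {..<M * h}"
      unfolding t F_def Let_def by (simp add: mult_add_less del: add_diff_assoc diff_add_assoc)
  next
    fix a b assume ab: "a \<in> {..<M * h}" "b \<in> {..<M * h}"
    define c where "c = (a div h) * M + b div h"
    have dm: "a div h < M" "b div h < M" using ab h by (auto simp: div_less_iff_less_mult)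
    then have cM: "c < M * M" unfolding c_def by (intro mult_add_less)
    have m: "a mod h < h" "b mod h < h" using h by auto
    have c2: "c div M = a div h" "c mod M = b div h" using dm by (simp_all add: c_def)
    define t t' where "t = c * (2 * h) + a mod h" and "t' = c * (2 * h) + (h + b mod h)"
    have dt: "t div (2 * h) = c" "t mod (2 * h) = a mod h" "t' div (2 * h) = c" "t' mod (2 * h) = h + b mod h"
    proof -
      have "a mod h < 2 * h" "h + b mod h < 2 * h" using m by linarith+
      then show "t div (2 * h) = c" "t mod (2 * h) = a mod h" "t' div (2 * h) = c" "t' mod (2 * h) = h + b mod h"
        unfolding t_def t'_def by (simp_all only: div_mult_self3 mod_mult_self3 div_less mod_less)
    qed
    have "near k xs (F t) (F t')"
      unfolding xs_def
    proof (rule near_upt)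
      show "t < M * M * (2 * h)" "t' < M * M * (2 * h)"
        unfolding t_def t'_def using m(1,2) by (intro mult_add_less cM; linarith)+
      have "t \<le> t'" "t' \<le> t + k" using m h unfolding t_def t'_def by linarith+
      then show "\<bar>int t - int t'\<bar> \<le> int k" by linarith
    qed
    moreover have "F t = a" "F t' = b" using m by (simp_all add: F_def dt c2)
    ultimately show "near k xs a b" by simp
  qed
  moreover have "v \<le> M * h"
    using h dividend_less_div_times[of h v] by (simp add: M_def algebra_simps less_imp_le)
  ultimately have "min_radius_length k v \<le> length xs" using assms by (intro min_radius_length_le[of k "{..<M * h}"]) auto
  then have "real (min_radius_length k v) \<le> real (M * M * (2 * h))" unfolding xs_def by (intro of_nat_mono) simp
  also have "\<dots> = 2 * (real M * real h) ^ 2 / real h" using h by (simp add: power2_eq_square)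
  also have "\<dots> \<le> 2 * (real v + real h) ^ 2 / real h"
  proof -
    have "M * h \<le> v + h" by (simp add: M_def algebra_simps)
    then have "real M * real h \<le> real v + real h" by (metis of_nat_add of_nat_le_iff of_nat_mult)
    then show ?thesis by (intro divide_right_mono mult_left_mono power_mono) auto
  qed
  also have "\<dots> = real v ^ 2 * (2 / real h) + 4 * real v + 2 * real h"
    using h by (simp add: field_simps power2_eq_square)
  also have "\<dots> \<le> real v ^ 2 * (4 / real k) + 4 * real v + (real k + 1)"
  proof (intro add_mono mult_left_mono order_refl)
    show "2 / real h \<le> 4 / real k" using h assms by (simp add: field_simps)
    show "2 * real h \<le> real k + 1" using h by linarith
  qed auto
  finally show ?thesis by (simp add: mult.commute)
qed

section \<open>The construction from lines in a grid\<close>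

lemma cong_linear_solvable:
  fixes d N c :: nat
  assumes "coprime d N" "N > 0"
  shows "\<exists>a<N. [a * d = c] (mod N)"
proof -
  obtain e where "[d * e = 1] (mod N)" using cong_solve_coprime_nat[OF assms(1)] by auto
  then have "[e * c mod N * d = 1 * c] (mod N)"
    using cong_scalar_right[of "d * e" 1 N c] unfolding cong_def
    by (metis mod_mult_left_eq mult.assoc mult.commute)
  then show ?thesis using assms by (intro exI[of _ "e * c mod N"]) auto
qed

lemma cong_shift_solvable:
  fixes u c N :: nat
  assumes "N > 0"
  shows "\<exists>j<N. [u + j = c] (mod N)"
proof -
  \<comment> \<open>The witness is \<open>c - u\<close> modulo \<open>N\<close>;
    \<open>N * u - u\<close> represents \<open>- u\<close> without truncated subtraction.\<close>
  have "u \<le> N * u" using assms by simp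
  then have "u + (c + (N * u - u)) = c + N * u" by linarith
  then have "[u + (c + (N * u - u)) mod N = c] (mod N)"
    unfolding cong_def by (metis mod_add_right_eq mod_mult_self2)
  then show ?thesis using assms by (intro exI[of _ "(c + (N * u - u)) mod N"]) auto
qed

text \<open>A letter is a triple of a residue \<open>x\<close> modulo \<open>N\<close>, a column
  \<open>i\<close> and an index \<open>e\<close> in its block; \<open>r + 1\<close> consecutive
  blocks fit into a window by \<open>(r + 1) * b \<le> k + 1\<close>. With
  \<open>s = 2 * r + 1\<close> columns, a column distance above \<open>r\<close> becomes one of at
  most \<open>r\<close> across the end of a line. The second summand treats each column as a
  separate alphabet of \<open>N * b\<close> letters.\<close>

lemma min_radius_length_lines:
  fixes N r b k n s :: nat
  assumes N: "N > 0" and b: "b > 0" "(r + 1) * b \<le> k + 1" and k: "k > 0"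
    and s: "s = 2 * r + 1" and cop: "\<And>d. 0 < d \<Longrightarrow> d < s \<Longrightarrow> coprime d N"
    and n: "0 < n" "n \<le> N * s * b"
  shows "min_radius_length k n \<le> N * (N + 1) * s * b + s * min_radius_length k (N * b)"
proof -
  have s0: "s > 0" using s by simp
  define A where "A = {..<N} \<times> {..<s} \<times> {..<b}"
  \<comment> \<open>\<open>G a j i e\<close> is the letter with index \<open>e\<close> in column
    \<open>i\<close> on line \<open>j\<close> of slope \<open>a\<close>; \<open>T\<close> gives its
    position and \<open>F\<close> decodes positions. Each slope has \<open>N + 1\<close> lines so
    that every line \<open>j < N\<close> is followed by a line \<open>j + 1\<close>.\<close>
  define G where "G = (\<lambda>a j i e. ((a * i + j) mod N, i, e :: nat))"
  define F where "F = (\<lambda>t. let u = t div b; w = u div s in G (w div (N + 1)) (w mod (N + 1)) (u mod s) (t mod b))"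
  define T where "T = (\<lambda>a j i e. ((a * (N + 1) + j) * s + i) * b + e)"
  define L where "L = N * (N + 1) * s * b"
  have T_add: "T a j (i + d) e = T a j i 0 + d * b + e" for a j i d e
    by (simp add: T_def algebra_simps)
  have F: "F (T a j i e) = G a j i e" if "j < N + 1" "i < s" "e < b" for a j i e
  proof -
    have "T a j i e div b = (a * (N + 1) + j) * s + i" "T a j i e mod b = e"
      using that by (simp_all add: T_def)
    moreover have "((a * (N + 1) + j) * s + i) div s = a * (N + 1) + j" "((a * (N + 1) + j) * s + i) mod s = i"
      using that by simp_all
    moreover have "(a * (N + 1) + j) div (N + 1) = a" "(a * (N + 1) + j) mod (N + 1) = j"
      using that by (simp_all only: div_mult_self3 mod_mult_self3 div_less mod_less)
    ultimately show ?thesis by (simp only: F_def Let_def)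
  qed
  have T: "T a j i e < L" if "a < N" "j < N + 1" "i < s" "e < b" for a j i e
    unfolding T_def L_def using that by (intro mult_add_less)
  have G: "G a j i e \<in> A" if "i < s" "e < b" for a j i e
    using that N by (auto simp: G_def A_def)
  have FA: "F t \<in> A" if "t < L" for t
    using s0 b by (simp add: F_def Let_def G)
  obtain ys where ys: "radius_sequence k {..<N * b} ys" "length ys = min_radius_length k (N * b)"
    using min_radius_length_attained[OF k] by blast
  define V where "V = (\<lambda>i::nat. map (\<lambda>v. (v mod N, i, v div N)) ys)"
  define zs where "zs = map F [0..<L] @ concat (map V [0..<s])"
  have lines: "near k zs (x, i, e) (y, i', e')"
    if x: "x < N" "y < N" and i: "i < i'" "i' < s" and e: "e < b" "e' < b" for x y i i' e e'
  proof -
    have shift: "a * i' + j = a * i + a * (i' - i) + j" for a j :: nat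
      using i by (simp flip: distrib_left)
    have "near k (map F [0..<L]) (x, i, e) (y, i', e')"
    proof (cases "i' - i \<le> r")
      case True
      \<comment> \<open>One line through both points needs \<open>a * i + j = x\<close> and
        \<open>a * i' + j = y\<close> modulo \<open>N\<close>, so the slope solves
        \<open>a * (i' - i) = y - x\<close>; \<open>N - x\<close> stands for
        \<open>- x\<close>.\<close>
      obtain a where a: "a < N" "[a * (i' - i) = y + (N - x)] (mod N)"
        using cong_linear_solvable[of "i' - i" N] cop i N by auto
      obtain j where j: "j < N" "[a * i + j = x] (mod N)"
        using cong_shift_solvable[OF N] by blast
      have "[(a * i + j) + a * (i' - i) = x + (y + (N - x))] (mod N)"
        using a j by (intro cong_add) auto
      also have "(a * i + j) + a * (i' - i) = a * i' + j"
        using shift[of a j] by simp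
      also have "x + (y + (N - x)) = y + N" using x by simp
      finally have j': "[a * i' + j = y] (mod N)" by (simp add: cong_def)
      have "(i' - i) * b \<le> r * b" using True by (intro mult_right_mono) auto
      moreover have "T a j i' e' = T a j i 0 + (i' - i) * b + e'"
        using T_add[of a j i "i' - i" e'] i by simp
      moreover have "T a j i e = T a j i 0 + e" by (simp add: T_def)
      ultimately have "\<bar>int (T a j i e) - int (T a j i' e')\<bar> \<le> int k"
        using e b(2) by (simp add: algebra_simps)
      then have "near k (map F [0..<L]) (F (T a j i e)) (F (T a j i' e'))"
        using a j i e by (intro near_upt T) auto
      then show ?thesis using a j j' i e x by (simp add: F G_def cong_def)
    next
      case False
      \<comment> \<open>Now line \<open>j\<close> is to pass through \<open>(y, i')\<close> and the
        next line through \<open>(x, i)\<close>, which shifts the congruence for the slope by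
        1.\<close>
      obtain a where a: "a < N" "[a * (i' - i) = y + 1 + (N - x)] (mod N)"
        using cong_linear_solvable[of "i' - i" N] cop i N by auto
      obtain j where j: "j < N" "[a * i' + j = y] (mod N)"
        using cong_shift_solvable[OF N] by blast
      have "[(a * i + (j + 1)) + (y + 1 + (N - x)) = (a * i + (j + 1)) + a * (i' - i)] (mod N)"
        using a by (intro cong_add) (auto simp: cong_sym)
      also have "(a * i + (j + 1)) + a * (i' - i) = (a * i' + j) + 1"
        using shift[of a j] by simp
      also have "[(a * i' + j) + 1 = y + 1] (mod N)"
        using j by (intro cong_add) auto
      also have "y + 1 + N = x + (y + 1 + (N - x))" using x by simp
      then have "[y + 1 = x + (y + 1 + (N - x))] (mod N)"
        unfolding cong_def by (metis mod_add_self2)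
      finally have j': "[a * i + (j + 1) = x] (mod N)"
        by (simp only: cong_add_rcancel_nat)
      \<comment> \<open>From column \<open>i'\<close> on line \<open>j\<close> to column
        \<open>i\<close> on line \<open>j + 1\<close> there are \<open>s + i - i'\<close> blocks, at
        most \<open>s - (r + 1) = r\<close>.\<close>
      have "(s + i - i') * b \<le> r * b" using False i s by (intro mult_right_mono) auto
      moreover have "T a (j + 1) i e = T a j i' 0 + (s + i - i') * b + e"
      proof -
        have "(a * (N + 1) + (j + 1)) * s + i = (a * (N + 1) + j) * s + i' + (s + i - i')"
          using i by (simp add: algebra_simps)
        then show ?thesis by (simp only: T_def add_mult_distrib[of _ "s + i - i'" b] add_0_right)
      qed
      moreover have "T a j i' e' = T a j i' 0 + e'" by (simp add: T_def)
      ultimately have "\<bar>int (T a (j + 1) i e) - int (T a j i' e')\<bar> \<le> int k"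
        using e b(2) by (simp add: algebra_simps)
      then have "near k (map F [0..<L]) (F (T a (j + 1) i e)) (F (T a j i' e'))"
        using a j i e by (intro near_upt T) auto
      then show ?thesis using a j j' i e x by (simp add: F G_def cong_def)
    qed
    then show ?thesis unfolding zs_def
      using near_append[where us="[]" and ys="map F [0..<L]" and vs="concat (map V [0..<s])"] by simp
  qed
  \<comment> \<open>Pairs within column \<open>i\<close> are found in the copy \<open>V i\<close> of
    \<open>ys\<close>, whose letters are coded as \<open>e * N + x\<close>.\<close>
  have group: "near k zs (x, i, e) (y, i, e')" if "x < N" "y < N" "i < s" "e < b" "e' < b" for x y i e e'
  proof -
    have "e * N + x < b * N" "e' * N + y < b * N" using that by (auto intro!: mult_add_less)
    then have "near k ys (e * N + x) (e' * N + y)"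
      using ys(1) unfolding radius_sequence_near by (simp add: mult.commute)
    from near_map[OF this, of "\<lambda>v. (v mod N, i, v div N)"]
    have "near k (V i) (x, i, e) (y, i, e')" using that by (simp add: V_def)
    then have "near k (concat (map V [0..<s])) (x, i, e) (y, i, e')"
      using that by (rule_tac near_concat[of _ "V i"]) auto
    then show ?thesis unfolding zs_def
      using near_append[where us="map F [0..<L]" and vs="[]"] by simp
  qed
  have "radius_sequence k A zs"
    unfolding radius_sequence_near
  proof (intro conjI ballI)
    have VA: "set (V i) \<subseteq> A" if "i < s" for i
      using ys(1) that N by (auto simp: V_def A_def radius_sequence_def less_mult_imp_div_less mult.commute)
    then show "set zs \<subseteq> A" using FA subsetD[OF VA] by (auto simp: zs_def)
    fix p q assume "p \<in> A" "q \<in> A"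
    then obtain x i e y i' e' where pq: "p = (x, i, e)" "q = (y, i', e')" "x < N" "i < s" "e < b" "y < N" "i' < s" "e' < b"
      by (auto simp: A_def)
    consider "i < i'" | "i' < i" | "i = i'" by linarith
    then show "near k zs p q"
    proof cases
      case 1
      then show ?thesis unfolding pq(1,2) using pq(3-8) by (intro lines)
    next
      case 2
      then show ?thesis unfolding pq(1,2) using pq(3-8) by (intro near_sym[OF lines])
    next
      case 3
      then show ?thesis unfolding pq(1,2) using pq(3-8) group by simp
    qed
  qed
  moreover have "finite A" "card A = N * s * b" by (auto simp: A_def)
  ultimately have "min_radius_length k n \<le> length zs"
    using n by (intro min_radius_length_le) auto
  also have "length zs = N * (N + 1) * s * b + s * length ys"
    by (simp add: zs_def L_def V_def length_concat o_def sum_list_triv)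
  finally show ?thesis using ys by simp
qed

lemma coprime_of_prime_gt:
  fixes d N :: nat
  assumes "0 < d" "\<And>p. prime p \<Longrightarrow> p dvd N \<Longrightarrow> d < p"
  shows "coprime d N"
proof (rule coprimeI)
  fix c assume c: "c dvd d" "c dvd N"
  show "is_unit c"
  proof (rule ccontr)
    assume "\<not> is_unit c"
    then have "c \<noteq> 1" by auto
    then obtain p where p: "prime p" "p dvd c" using prime_factor_nat by blast
    then have "p dvd N" "p dvd d" using c dvd_trans by blast+
    then show False using assms(1) assms(2)[OF p(1)] dvd_imp_le[of p d] by simp
  qed
qed

(* With m = n / k, the number r of blocks of letters per window is about min (sqrt k) (m^0.2375). *)
lemma min_radius_length_upper:
  "\<exists>M0. \<forall>n k. k > 0 \<longrightarrow> real n \<ge> M0 * real k \<longrightarrow>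
     real (min_radius_length k n) \<le> real n ^ 2 / (2 * real k) *
       (1 + 100 * (1 / sqrt (real k) + (real n / real k / 4) powr (-0.2375)))"
proof -
  obtain X0 where X0: "\<And>X. X \<ge> X0 \<Longrightarrow> \<exists>N::nat. X \<le> real N \<and> real N \<le> X + X powr 0.7625 \<and>
     (\<forall>p. prime p \<longrightarrow> p dvd N \<longrightarrow> real p > X powr 0.2375)"
    using almost_prime_in_short_interval by blast
  have "eventually (\<lambda>x::real. x powr 0.2375 \<ge> 2 \<and> x \<ge> 1 \<and> x \<ge> X0) at_top"
    by (intro eventually_conj eventually_ge_at_top) real_asymp
  then obtain x0 where x0: "\<And>x. x \<ge> x0 \<Longrightarrow> x powr 0.2375 \<ge> 2 \<and> x \<ge> 1 \<and> x \<ge> X0"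
    unfolding eventually_at_top_linorder by blast
  have "real (min_radius_length k n) \<le> real n ^ 2 / (2 * real k) *
       (1 + 100 * (1 / sqrt (real k) + (real n / real k / 4) powr (-0.2375)))"
    if k: "k > 0" and nk: "real n \<ge> 4 * x0 * real k" for n k :: nat
  proof -
    \<comment> \<open>Since \<open>q \<le> 4 * k\<close> below, \<open>m\<close> is a lower bound
      for the target \<open>X = n / q\<close>.\<close>
    define m where "m = real n / real k / 4"
    have "m \<ge> x0" using k nk by (simp add: m_def field_simps)
    from x0[OF this] have m: "m powr 0.2375 \<ge> 2" "m \<ge> 1" "m \<ge> X0" by auto
    have nm: "real n = 4 * m * real k" using k by (simp add: m_def)
    have n0: "real n > 0" using nm m k by simp
    define \<kappa> \<mu> where "\<kappa> = 1 / sqrt (real k)" and "\<mu> = m powr (-0.2375)"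
    have \<mu>: "\<mu> > 0" "1 / m \<le> \<mu>" "\<mu> = 1 / m powr 0.2375"
      using m powr_mono[of "-1" "-0.2375" m] by (auto simp: \<mu>_def powr_minus_divide)
    have \<kappa>: "\<kappa> > 0" using k by (simp add: \<kappa>_def)
    \<comment> \<open>The bound \<open>sqrt k\<close> balances the errors \<open>1 / r\<close> and
      \<open>r / k\<close>; the other one ensures \<open>2 * r \<le> m powr 0.2375\<close>, which
      makes \<open>N\<close> coprime to 1, ..., \<open>2 * r\<close>.\<close>
    define w where "w = min (sqrt (real k)) (m powr 0.2375 / 2)"
    have w: "w \<ge> 1" using k m by (simp add: w_def)
    define r where "r = nat \<lfloor>w\<rfloor>"
    have r: "real r \<le> w" "w < real r + 1" "r \<ge> 1" using w unfolding r_def by linarith+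
    have r1: "real r \<ge> 1" using r by simp
    have r_inv: "1 / real r \<le> 2 * \<kappa> + 4 * \<mu>"
    proof -
      have "w \<le> 2 * real r" using r r1 by linarith
      then have "1 / real r \<le> 2 / w" using w r1 by (simp add: field_simps)
      also have "2 / w \<le> 2 / sqrt (real k) + 2 / (m powr 0.2375 / 2)"
        using m by (cases "sqrt (real k) \<le> m powr 0.2375 / 2") (auto simp: w_def min_def)
      also have "\<dots> = 2 * \<kappa> + 4 * \<mu>" by (simp add: \<kappa>_def \<mu>(3))
      finally show ?thesis .
    qed
    have r_sqrt: "real r \<le> sqrt (real k)" using r by (simp add: w_def)
    have rk: "real r / real k \<le> \<kappa>"
    proof -
      have "real r / real k \<le> sqrt (real k) / real k" using r_sqrt by (intro divide_right_mono) auto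
      also have "\<dots> = \<kappa>" using k by (simp add: \<kappa>_def real_div_sqrt field_simps)
      finally show ?thesis .
    qed
    have r2k: "real r ^ 2 \<le> real k"
      using power_mono[OF r_sqrt, of 2] by simp
    then have r_le_k: "r \<le> k"
      using self_le_power[of "real r" 2] r1 by (simp flip: of_nat_le_iff)
    have r_m: "2 * real r \<le> m powr 0.2375" using r by (simp add: w_def)
    define s b where "s = 2 * r + 1" and "b = (k + 1) div (r + 1)"
    have b: "b > 0" "(r + 1) * b \<le> k + 1"
    proof -
      show "b > 0" using r_le_k by (simp add: b_def div_greater_zero_iff)
      show "(r + 1) * b \<le> k + 1" unfolding b_def by (rule times_div_less_eq_dividend)
    qed
    \<comment> \<open>\<open>q\<close> counts the letters for each residue modulo \<open>N\<close>,
      ideally about \<open>2 * k\<close>; the grid holds all letters once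
      \<open>N \<ge> n / q\<close>.\<close>
    define q where "q = real s * real b"
    have q0: "q > 0" using b by (simp add: q_def s_def)
    have q_le: "q \<le> 4 * real k"
    proof -
      have "s * b \<le> 2 * ((r + 1) * b)" by (simp add: s_def)
      also have "\<dots> \<le> 2 * (k + 1)" using b by simp
      also have "\<dots> \<le> 4 * k" using k by simp
      finally show ?thesis by (simp add: q_def flip: of_nat_mult of_nat_le_iff)
    qed
    \<comment> \<open>\<open>\<beta>\<close> bounds the relative shortfall of \<open>q\<close> from
      \<open>2 * k\<close>: the first term is the gap between
      \<open>(2 * r + 1) / (2 * r + 2)\<close> and 1, the second comes from rounding
      \<open>b\<close> down.\<close>
    define \<beta> where "\<beta> = 1 / (2 * (real r + 1)) + (real r - 1) / real k"
    have \<beta>0: "\<beta> \<ge> 0" using r1 by (simp add: \<beta>_def)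
    have \<beta>: "\<beta> \<le> 1 / 2"
    proof -
      have "1 / (2 * (real r + 1)) \<le> 1 / 4" using r1 by simp
      moreover have "(real r - 1) / real k \<le> 1 / 4"
      proof -
        have "0 \<le> (real r - 2) ^ 2" by simp
        then have "4 * (real r - 1) \<le> real r ^ 2" by (simp add: power2_eq_square algebra_simps)
        then have "4 * (real r - 1) \<le> real k" using r2k by linarith
        then show ?thesis using k by (simp add: field_simps)
      qed
      ultimately show ?thesis unfolding \<beta>_def by linarith
    qed
    have q_ge: "2 * real k * (1 - \<beta>) \<le> q"
    proof -
      have "k + 1 < (r + 1) * (b + 1)"
        using dividend_less_times_div[of "r + 1" "k + 1"] by (simp add: b_def)
      then have "k + 1 \<le> (r + 1) * b + r" by simp
      then have "real (k + 1) \<le> real ((r + 1) * b + r)" by (rule of_nat_mono)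
      then have "real k - (real r - 1) \<le> (real r + 1) * real b" by (simp add: algebra_simps)
      then have bb: "(real k - (real r - 1)) / (real r + 1) \<le> real b" by (simp add: field_simps)
      have "2 * real k * (1 - \<beta>) \<le> 2 * real k * ((1 - 1 / (2 * (real r + 1))) * (1 - (real r - 1) / real k))"
      proof (intro mult_left_mono)
        have "1 - (u + v) \<le> (1 - u) * (1 - v)" if "0 \<le> u * v" for u v :: real
          using that by (simp add: algebra_simps)
        then show "1 - \<beta> \<le> (1 - 1 / (2 * (real r + 1))) * (1 - (real r - 1) / real k)"
          unfolding \<beta>_def using r1 by (metis diff_ge_0_iff_ge mult_nonneg_nonneg divide_nonneg_nonneg of_nat_0_le_iff
              add_nonneg_nonneg zero_le_one zero_le_numeral)
      qed simp
      also have "1 - 1 / (2 * (real r + 1)) = (2 * real r + 1) / (2 * (real r + 1))"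
        using r1 by (simp add: field_simps)
      also have "1 - (real r - 1) / real k = (real k - (real r - 1)) / real k"
        using k by (simp add: diff_divide_distrib)
      also have "2 * real k * ((2 * real r + 1) / (2 * (real r + 1)) * ((real k - (real r - 1)) / real k))
          = (2 * real r + 1) * ((real k - (real r - 1)) / (real r + 1))"
      proof -
        have "2 * x * (u / (2 * v) * (t / x)) = u * (t / v)" if "x \<noteq> 0" for u v t x :: real
          using that by simp
        note cancel = this
        show ?thesis by (rule cancel) (use k in simp)
      qed
      also have "\<dots> \<le> (2 * real r + 1) * real b"
        using bb by (intro mult_left_mono) auto
      also have "\<dots> = q" by (simp add: q_def s_def)
      finally show ?thesis .
    qed
    define X where "X = real n / q"
    have Xq: "X * q = real n" using q0 by (simp add: X_def)
    have X_m: "m \<le> X"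
    proof -
      have "m * q \<le> m * (4 * real k)" using q_le m by (intro mult_left_mono) auto
      then show ?thesis using q0 by (simp add: X_def nm field_simps)
    qed
    then have X: "X \<ge> 1" "X \<ge> X0" using m by auto
    have X_le: "X \<le> real n / (2 * real k) * (1 + 2 * \<beta>)"
    proof -
      \<comment> \<open>For \<open>\<beta> \<le> 1 / 2\<close> the factor
        \<open>1 + 2 * \<beta>\<close> dominates \<open>1 / (1 - \<beta>)\<close>.\<close>
      have "(1 - \<beta>) * (1 + 2 * \<beta>) \<ge> 1"
        using \<beta> \<beta>0 mult_nonneg_nonneg[of \<beta> "1 - 2 * \<beta>"] by (simp add: algebra_simps)
      then have "2 * real k \<le> 2 * real k * ((1 - \<beta>) * (1 + 2 * \<beta>))"
        using mult_left_mono[of 1 "(1 - \<beta>) * (1 + 2 * \<beta>)" "2 * real k"] by simp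
      also have "\<dots> \<le> q * (1 + 2 * \<beta>)"
        using q_ge \<beta>0 mult_right_mono[of "2 * real k * (1 - \<beta>)" q "1 + 2 * \<beta>"] by (simp add: mult.assoc)
      finally have "real n * (2 * real k) \<le> real n * (q * (1 + 2 * \<beta>))" by (intro mult_left_mono) auto
      then show ?thesis using q0 k by (simp add: X_def field_simps)
    qed
    obtain N where N: "X \<le> real N" "real N \<le> X + X powr 0.7625"
        "\<And>p. prime p \<Longrightarrow> p dvd N \<Longrightarrow> real p > X powr 0.2375"
      using X0[OF X(2)] by blast
    \<comment> \<open>The relative excess allowed for \<open>N\<close> over \<open>X\<close>, as
      \<open>X powr 0.7625 = X * \<epsilon>\<close>.\<close>
    define \<epsilon> where "\<epsilon> = X powr (-0.2375)"
    have \<epsilon>: "0 \<le> \<epsilon>" "\<epsilon> \<le> 1" "\<epsilon> \<le> \<mu>"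
      using X m X_m powr_mono[of "-0.2375" 0 X] by (auto simp: \<epsilon>_def \<mu>_def intro: powr_mono2')
    have NX: "real N \<le> X * (1 + \<epsilon>)"
    proof -
      have "X powr 1 * X powr (-0.2375) = X powr 0.7625" unfolding powr_add[symmetric] by simp
      then show ?thesis using N X by (simp add: \<epsilon>_def distrib_left)
    qed
    have N0: "N > 0" using N X by (auto intro!: Nat.gr0I)
    have main: "min_radius_length k n \<le> N * (N + 1) * s * b + s * min_radius_length k (N * b)"
    proof (rule min_radius_length_lines[OF N0 b k s_def])
      fix d assume d: "0 < d" "d < s"
      show "coprime d N"
      proof (rule coprime_of_prime_gt[OF d(1)])
        fix p assume "prime p" "p dvd N"
        then have "real p > X powr 0.2375" by (rule N)
        moreover have "m powr 0.2375 \<le> X powr 0.2375" using X_m m by (intro powr_mono2) auto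
        ultimately have "2 * real r < real p" using r_m by linarith
        then show "d < p" using d by (simp add: s_def)
      qed
    next
      show "0 < n" using n0 by simp
      have "real n \<le> real N * q" using N q0 Xq mult_right_mono[of X "real N" q] by simp
      then have "real n \<le> real (N * s * b)" by (simp add: q_def mult_ac)
      then show "n \<le> N * s * b" by (rule of_nat_le_iff[THEN iffD1])
    qed
    define P where "P = real n ^ 2 / (2 * real k)"
    have P0: "P \<ge> 0" by (simp add: P_def)
    \<comment> \<open>Terms of order \<open>n\<close> are smaller than the main term
      \<open>P\<close> by a factor of order \<open>m\<close>.\<close>
    have n_P: "real n = P * (1 / (2 * m))" using k m by (simp add: P_def nm power2_eq_square field_simps)
    have NXq: "real N * q \<le> 2 * real n"
    proof -
      have "real N \<le> X * 2" using order_trans[OF NX mult_left_mono[of "1 + \<epsilon>" 2 X]] \<epsilon> X by simp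
      then have "real N * q \<le> X * 2 * q" using q0 by (intro mult_right_mono) auto
      then show ?thesis using Xq by simp
    qed
    have part1: "real (N * (N + 1) * s * b) \<le> P * (1 + 2 * \<beta> + 6 * \<epsilon> + 1 / m)"
    proof -
      have "real N * q * real N \<le> (real n * (1 + \<epsilon>)) * (X * (1 + \<epsilon>))"
      proof (rule mult_mono[OF _ NX])
        have "real N * q \<le> X * (1 + \<epsilon>) * q" using NX q0 by (intro mult_right_mono) auto
        also have "\<dots> = X * q * (1 + \<epsilon>)" by simp
        finally show "real N * q \<le> real n * (1 + \<epsilon>)" unfolding Xq .
      qed (use \<epsilon> in auto)
      also have "\<dots> = (real n * X) * ((1 + \<epsilon>) * (1 + \<epsilon>))" by simp
      also have "\<dots> \<le> (real n * (real n / (2 * real k) * (1 + 2 * \<beta>))) * (1 + 3 * \<epsilon>)"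
      proof (rule mult_mono)
        show "real n * X \<le> real n * (real n / (2 * real k) * (1 + 2 * \<beta>))"
          using X_le by (rule mult_left_mono) simp
        show "(1 + \<epsilon>) * (1 + \<epsilon>) \<le> 1 + 3 * \<epsilon>"
          using \<epsilon> mult_left_mono[of \<epsilon> 1 \<epsilon>] by (simp add: algebra_simps)
      qed (use \<epsilon> \<beta>0 in auto)
      also have "\<dots> = P * ((1 + 2 * \<beta>) * (1 + 3 * \<epsilon>))" by (simp add: P_def power2_eq_square)
      also have "\<dots> \<le> P * (1 + 2 * \<beta> + 6 * \<epsilon>)"
      proof (intro mult_left_mono P0)
        have "\<beta> * \<epsilon> \<le> 1 / 2 * \<epsilon>" using \<beta> \<epsilon> by (intro mult_right_mono) auto
        then show "(1 + 2 * \<beta>) * (1 + 3 * \<epsilon>) \<le> 1 + 2 * \<beta> + 6 * \<epsilon>" by (simp add: algebra_simps)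
      qed
      finally have "real N * q * real N \<le> P * (1 + 2 * \<beta> + 6 * \<epsilon>)" .
      moreover have "real N * q \<le> P * (1 / m)"
        using NXq n_P by simp
      moreover have "real (N * (N + 1) * s * b) = real N * q * real N + real N * q"
        by (simp add: q_def algebra_simps)
      ultimately show ?thesis by (simp add: distrib_left)
    qed
    \<comment> \<open>The crude bound is quadratic in the column size, which is a fraction
      \<open>1 / s\<close> of the grid, so all \<open>s\<close> columns together cost a share of
      order \<open>1 / r\<close> of \<open>P\<close>, up to terms of order
      \<open>P / m\<close>.\<close>
    have part2: "real (s * min_radius_length k (N * b)) \<le> P * (16 / real r + 6 / m)"
    proof -
      have "real (min_radius_length k (N * b)) \<le> 4 * real (N * b) ^ 2 / real k + 4 * real (N * b) + real k + 1"
        using N0 b k by (intro min_radius_length_crude) auto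
      then have "real (s * min_radius_length k (N * b)) \<le>
          real s * (4 * real (N * b) ^ 2 / real k + 4 * real (N * b) + real k + 1)"
        by (simp add: mult_left_mono)
      also have "\<dots> = 4 * (real N * q) ^ 2 / (real s * real k) + 4 * (real N * q) + real s * (real k + 1)"
      proof -
        have "t * (4 * (u * v) ^ 2 / w + 4 * (u * v) + w + 1) =
            4 * (u * (t * v)) ^ 2 / (t * w) + 4 * (u * (t * v)) + t * (w + 1)" if "t > 0" for t u v w :: real
          using that by (simp add: power2_eq_square distrib_left mult_ac)
        then show ?thesis by (simp add: q_def s_def)
      qed
      also have "\<dots> \<le> P * (16 / real r) + P * (4 / m) + P * (2 / m)"
      proof (intro add_mono)
        have "4 * (real N * q) ^ 2 / (real s * real k) \<le> 4 * (2 * real n) ^ 2 / (2 * real r * real k)"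
          using NXq q0 k r1 by (intro frac_le mult_left_mono power_mono mult_right_mono) (auto simp: s_def)
        also have "\<dots> = P * (16 / real r)" by (simp add: P_def power2_eq_square)
        finally show "4 * (real N * q) ^ 2 / (real s * real k) \<le> P * (16 / real r)" .
        have "4 * (real N * q) \<le> 8 * real n" using NXq by linarith
        also have "8 * real n = P * (4 / m)" by (subst n_P) simp
        finally show "4 * (real N * q) \<le> P * (4 / m)" .
        have "m powr 0.2375 \<le> m powr 1" using m by (intro powr_mono) auto
        then have "real s \<le> 2 * m" using r_m m by (simp add: s_def)
        then have "real s * (real k + 1) \<le> 2 * m * (2 * real k)" using k m by (intro mult_mono) auto
        also have "\<dots> \<le> 4 * real n" using nm n0 by simp
        also have "4 * real n = P * (2 / m)" by (subst n_P) simp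
        finally show "real s * (real k + 1) \<le> P * (2 / m)" .
      qed
      finally show ?thesis by (simp add: algebra_simps)
    qed
    have "real (min_radius_length k n) \<le> real (N * (N + 1) * s * b + s * min_radius_length k (N * b))"
      using main by (rule of_nat_mono)
    also have "\<dots> \<le> P * (1 + 2 * \<beta> + 6 * \<epsilon> + 1 / m) + P * (16 / real r + 6 / m)"
      using part1 part2 by simp
    also have "\<dots> = P * (1 + (2 * \<beta> + 6 * \<epsilon> + 7 / m + 16 / real r))" by (simp add: algebra_simps)
    also have "\<dots> \<le> P * (1 + 100 * (\<kappa> + \<mu>))"
    proof (intro mult_left_mono add_left_mono P0)
      have "2 * \<beta> \<le> 1 / real r + 2 * (real r / real k)"
      proof -
        have "1 / (2 * (real r + 1)) \<le> 1 / (2 * real r)" using r1 by (intro divide_left_mono) auto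
        moreover have "(real r - 1) / real k \<le> real r / real k" by (intro divide_right_mono) auto
        ultimately have "\<beta> \<le> 1 / (2 * real r) + real r / real k"
          unfolding \<beta>_def by (rule add_mono)
        then have "2 * \<beta> \<le> 2 * (1 / (2 * real r) + real r / real k)" by (intro mult_left_mono) simp_all
        also have "\<dots> = 1 / real r + 2 * (real r / real k)" by (simp add: distrib_left)
        finally show ?thesis .
      qed
      moreover have "7 / m \<le> 7 * \<mu>" using \<mu> by simp
      moreover have "16 / real r = 16 * (1 / real r)" by simp
      ultimately have "2 * \<beta> + 6 * \<epsilon> + 7 / m + 16 / real r \<le> 17 * (1 / real r) + 2 * \<kappa> + 13 * \<mu>"
        using rk \<epsilon> by linarith
      \<comment> \<open>This amounts to \<open>36 * \<kappa> + 81 * \<mu>\<close>, whence the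
        constant 100.\<close>
      also have "\<dots> \<le> 17 * (2 * \<kappa> + 4 * \<mu>) + 2 * \<kappa> + 13 * \<mu>"
        by (intro add_right_mono mult_left_mono r_inv) simp
      also have "\<dots> \<le> 100 * (\<kappa> + \<mu>)" using \<kappa> \<mu>(1) by (simp add: algebra_simps)
      finally show "2 * \<beta> + 6 * \<epsilon> + 7 / m + 16 / real r \<le> 100 * (\<kappa> + \<mu>)" .
    qed
    finally show ?thesis by (simp add: P_def \<kappa>_def \<mu>_def m_def)
  qed
  then show ?thesis by (intro exI[of _ "4 * x0"]) auto
qed

section \<open>Asymptotics when \<open>k\<close> is the floor of
  \<open>n powr \<alpha>\<close>\<close>

theorem theorem3:
  fixes \<delta> \<alpha> :: real
  assumes "\<delta> = 0.525" and "0 < \<alpha>" and "\<alpha> < 1"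
  shows "(\<lambda>n :: nat. real (min_radius_length (nat \<lfloor>real n powr \<alpha>\<rfloor>) n)
              - 1 / (2 * of_int \<lfloor>real n powr \<alpha>\<rfloor>) * real n ^ 2)
         \<in> O(\<lambda>n. if \<alpha> \<le> (1 - \<delta>) / (2 - \<delta>)
                  then real n powr (2 - 3 / 2 * \<alpha>)
                  else real n powr (2 - \<alpha> - 1 / 2 * (1 - \<delta>) * (1 - \<alpha>)))"
proof -
  \<comment> \<open>Multiplied by \<open>n ^ 2 / (2 * k)\<close>, the error
    \<open>1 / sqrt k\<close> yields the exponent \<open>e1\<close> and the sieve error yields
    \<open>e2\<close>; here \<open>0.2375 = (1 - \<delta>) / 2\<close>.\<close>
  define e1 e2 where "e1 = 2 - 3 / 2 * \<alpha>" and "e2 = 2 - \<alpha> - 0.2375 * (1 - \<alpha>)"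
  define e where "e = (if \<alpha> \<le> (1 - \<delta>) / (2 - \<delta>) then e1 else e2)"
  have thr: "(1 - \<delta>) / (2 - \<delta>) = 19 / 59" unfolding assms(1) by simp
  \<comment> \<open>The two exponents cross at \<open>\<alpha> = 19 / 59\<close>, so
    \<open>e\<close> is always the larger one. The last inequality absorbs the term
    \<open>n / (2 * k)\<close> of the lower bound.\<close>
  have e: "e1 \<le> e" "e2 \<le> e" "1 - \<alpha> \<le> e"
  proof -
    have e2_alt: "e2 = 2 - \<alpha> - 19 / 80 * (1 - \<alpha>)" by (simp add: e2_def)
    have "e2 \<le> e1" "1 - \<alpha> \<le> e1" if "\<alpha> \<le> 19 / 59"
      unfolding e1_def e2_alt using that assms(2,3) by (simp_all add: field_simps)
    moreover have "e1 \<le> e2" "1 - \<alpha> \<le> e2" if "\<not> \<alpha> \<le> 19 / 59"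
      unfolding e1_def e2_alt using that assms(2,3) by (simp_all add: field_simps)
    ultimately show "e1 \<le> e" "e2 \<le> e" "1 - \<alpha> \<le> e" unfolding e_def thr by auto
  qed
  obtain M0 where M0: "\<And>n k. k > 0 \<Longrightarrow> real n \<ge> M0 * real k \<Longrightarrow>
     real (min_radius_length k n) \<le> real n ^ 2 / (2 * real k) *
       (1 + 100 * (1 / sqrt (real k) + (real n / real k / 4) powr (-0.2375)))"
    using min_radius_length_upper by blast
  \<comment> \<open>As \<open>n / k \<ge> n powr (1 - \<alpha>)\<close> tends to infinity, the upper
    bound applies to all large \<open>n\<close>.\<close>
  have "eventually (\<lambda>n. real n powr (1 - \<alpha>) \<ge> M0) at_top"
    using assms by (intro filterlim_at_top[THEN iffD1, rule_format]) real_asymp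
  moreover have "eventually (\<lambda>n::nat. n \<ge> 1) at_top" by (rule eventually_ge_at_top)
  ultimately have "eventually (\<lambda>n. norm (real (min_radius_length (nat \<lfloor>real n powr \<alpha>\<rfloor>) n)
              - 1 / (2 * of_int \<lfloor>real n powr \<alpha>\<rfloor>) * real n ^ 2) \<le> 400 * norm (real n powr e)) at_top"
  proof eventually_elim
    case (elim n)
    define k where "k = nat \<lfloor>real n powr \<alpha>\<rfloor>"
    have n: "real n \<ge> 1" using elim by simp
    then have p1: "real n powr \<alpha> \<ge> 1" using assms by (simp add: ge_one_powr_ge_zero)
    then have fl: "of_int \<lfloor>real n powr \<alpha>\<rfloor> = real k" by (simp add: k_def)
    have k1: "real k \<ge> 1" using p1 unfolding fl[symmetric] by simp
    then have k: "real k \<le> real n powr \<alpha>" "real n powr \<alpha> \<le> 2 * real k" "k > 0"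
      using fl by (linarith, linarith, simp)
    have nk: "real n powr (1 - \<alpha>) \<le> real n / real k"
      using k n by (simp add: powr_diff frac_le)
    have "M0 \<le> real n / real k" using elim(1) nk by linarith
    then have "M0 * real k \<le> real n" using k1 by (simp add: pos_le_divide_eq)
    from M0[OF k(3) this]
    have up: "real (min_radius_length k n) - real n ^ 2 / (2 * real k) \<le>
        real n ^ 2 / (2 * real k) * (100 * (1 / sqrt (real k) + (real n / real k / 4) powr (-0.2375)))"
      by (simp add: algebra_simps)
    have n2: "real n ^ 2 / (2 * real k) \<le> real n powr (2 - \<alpha>)"
    proof -
      have "real n ^ 2 / (2 * real k) \<le> real n ^ 2 / real n powr \<alpha>"
        using k n by (intro divide_left_mono mult_pos_pos) auto
      also have "\<dots> = real n powr (2 - \<alpha>)" using n by (simp add: powr_diff)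
      finally show ?thesis .
    qed
    have s1: "1 / sqrt (real k) \<le> 2 * real n powr (- \<alpha> / 2)"
    proof -
      have "real n powr \<alpha> \<le> 4 * real k" using k by linarith
      then have "sqrt (real n powr \<alpha>) \<le> sqrt (4 * real k)" by simp
      also have "\<dots> = 2 * sqrt (real k)" by (simp add: real_sqrt_mult)
      also have "sqrt (real n powr \<alpha>) = real n powr (\<alpha> / 2)"
        using n by (simp add: powr_half_sqrt[symmetric] powr_powr)
      finally show ?thesis using k n by (simp add: powr_minus_divide field_simps)
    qed
    have s2: "(real n / real k / 4) powr (-0.2375) \<le> 2 * real n powr (- 0.2375 * (1 - \<alpha>))"
    proof -
      have "(real n / real k / 4) powr (-0.2375) \<le> (real n powr (1 - \<alpha>) / 4) powr (-0.2375)"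
        using nk n by (intro powr_mono2') auto
      also have "\<dots> = real n powr (- 0.2375 * (1 - \<alpha>)) * 4 powr 0.2375"
        using n by (simp add: powr_divide powr_powr powr_minus field_simps)
      also have "\<dots> \<le> real n powr (- 0.2375 * (1 - \<alpha>)) * 2"
      proof (intro mult_left_mono)
        have "(4::real) powr 0.2375 \<le> 4 powr (1 / 2)" by (intro powr_mono) auto
        then show "(4::real) powr 0.2375 \<le> 2" by (simp add: powr_half_sqrt)
      qed auto
      finally show ?thesis by (simp only: mult.commute)
    qed
    have "real (min_radius_length k n) - real n ^ 2 / (2 * real k) \<le>
        real n powr (2 - \<alpha>) * (100 * (2 * real n powr (- \<alpha> / 2) + 2 * real n powr (- 0.2375 * (1 - \<alpha>))))"
      using n2 s1 s2 by (intro order_trans[OF up] mult_mono mult_left_mono add_mono) auto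
    also have "\<dots> = 200 * real n powr e1 + 200 * real n powr e2"
    proof -
      have exps: "real n powr (2 - \<alpha>) * real n powr (- \<alpha> / 2) = real n powr e1"
        "real n powr (2 - \<alpha>) * real n powr (- 0.2375 * (1 - \<alpha>)) = real n powr e2"
        unfolding powr_add[symmetric] e1_def e2_def
        by (rule arg_cong[where f="\<lambda>x. real n powr x"], simp add: field_simps)+
      have "p * (100 * (2 * a + 2 * b)) = 200 * (p * a) + 200 * (p * b)" for p a b :: real
        by (simp add: algebra_simps)
      note distr = this
      show ?thesis unfolding distr exps ..
    qed
    also have "\<dots> \<le> 200 * real n powr e + 200 * real n powr e"
      using n e by (intro add_mono mult_left_mono powr_mono) auto
    finally have 1: "real (min_radius_length k n) - real n ^ 2 / (2 * real k) \<le> 400 * real n powr e" by simp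
    \<comment> \<open>The opposite inequality follows from the pair count, with an error of only
      \<open>n / (2 * k)\<close>.\<close>
    have "real (n * (n - 1)) \<le> real (2 * k * min_radius_length k n)"
      by (intro of_nat_mono min_radius_length_lower k)
    then have "real n ^ 2 - real n \<le> 2 * real k * real (min_radius_length k n)"
      using n by (simp add: of_nat_diff power2_eq_square algebra_simps)
    then have "real n ^ 2 / (2 * real k) - real n / (2 * real k) \<le> real (min_radius_length k n)"
      using k by (simp add: field_simps)
    moreover have "real n / (2 * real k) \<le> real n powr (1 - \<alpha>)"
    proof -
      have "real n / (2 * real k) \<le> real n / real n powr \<alpha>"
        using k n by (intro divide_left_mono mult_pos_pos) auto
      then show ?thesis using n by (simp add: powr_diff)
    qed
    moreover have "real n powr (1 - \<alpha>) \<le> real n powr e" using n e by (intro powr_mono) auto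
    moreover have "real n powr e \<ge> 0" by simp
    ultimately have 2: "real n ^ 2 / (2 * real k) - real (min_radius_length k n) \<le> 400 * real n powr e" by linarith
    show ?case using 1 2 unfolding fl k_def[symmetric] by (simp add: abs_le_iff)
  qed
  then have "(\<lambda>n :: nat. real (min_radius_length (nat \<lfloor>real n powr \<alpha>\<rfloor>) n)
              - 1 / (2 * of_int \<lfloor>real n powr \<alpha>\<rfloor>) * real n ^ 2) \<in> O(\<lambda>n. real n powr e)"
    by (rule bigoI)
  also have "(\<lambda>n. real n powr e) = (\<lambda>n. if \<alpha> \<le> (1 - \<delta>) / (2 - \<delta>)
                  then real n powr (2 - 3 / 2 * \<alpha>)
                  else real n powr (2 - \<alpha> - 1 / 2 * (1 - \<delta>) * (1 - \<alpha>)))"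
    by (auto simp: e_def e1_def e2_def assms(1))
  finally show ?thesis .
qed

end
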